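(* Let $n\geq1$ and let $X_1,\ldots,X_n$ be independent random variables with finite entropies in a connected, compact and metrizable topological abelian group $G$. Let $S_n=\sum_{i=1}^nX_i$ and let $j^*$ be an index that achieves $h(X_{j^*})=\max_{1\leq i\leq n}h(X_i)$, with any ties broken arbitrarily. Then $$D(S_n\|U_G)\leq\Big[\prod_{1\leq i\leq n,\ i\neq j^*}r(h(X_i))\Big]D(X_{j^*}\|U_G)\leq r\Bigl(\min_{1\leq i\leq n}h(X_i)\Bigr)^{n-1}\min_{1\leq i\leq n}D(X_i\|U_G),$$ where $$r(x)=1-\min\left\{\frac14,\ \frac{\bigl(1-\operatorname{sinc}(e^{6x-2})^2\bigr)^2}{8+16\,\frac{\operatorname{sinc}(e^{6x-2})^2}{e^{6x-2}}}\right\},\qquad x\in(-\infty,0],$$ and $\operatorname{sinc}(x)=\frac{\sin(\pi x)}{\pi x}$.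
   Context: $G$ carries its Borel $\sigma$-algebra; let $\mu$ be the unique Haar probability measure on $G$. For a $G$-valued random variable $X$, the entropy is $h(X):=-\int_G f\log f\,d\mu$ if the law of $X$ has a density $f$ with respect to $\mu$, and $h(X):=-\infty$ otherwise ($\log$ is the natural logarithm); one always has $h(X)\in[-\infty,0]$. "Finite entropy" means $h(X)>-\infty$. $U_G$ denotes a random variable with law $\mu$, and $D(X\|U_G)$ is the relative entropy between the laws of $X$ and $U_G$, so that $D(X\|U_G)=-h(X)$. An empty product equals $1$. *)

theory Defs
  imports "HOL-Probability.Probability"
begin

text \<open>
  The Haar probability measure is characterised by left invariance on Borel sets. On a compact
  metrizable space every finite Borel measure is regular, so no regularity condition is needed.
\<close>

definition haar_prob :: "'g::topological_ab_group_add measure \<Rightarrow> bool" where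
  "haar_prob \<mu> \<longleftrightarrow>
     prob_space \<mu> \<and> sets \<mu> = sets borel \<and>
     (\<forall>a. \<forall>A\<in>sets borel. emeasure \<mu> ((\<lambda>x. a + x) ` A) = emeasure \<mu> A)"

text \<open>
  The extended-valued Lebesgue integral. The Bochner integral is not suitable here: it is \<open>0\<close> for a
  non-integrable function, which would make a random variable of entropy \<open>-\<infinity>\<close> with a density look
  like one of entropy \<open>0\<close>. Below, the negative part always has finite integral
  (\<open>t * ln t \<ge> - 1 / e\<close> on a probability space), so \<open>\<infinity> - \<infinity>\<close> does not occur.
\<close>

definition ext_integral :: "'a measure \<Rightarrow> ('a \<Rightarrow> real) \<Rightarrow> ereal" where
  "ext_integral M f =
     enn2ereal (\<integral>\<^sup>+x. ennreal (f x) \<partial>M) - enn2ereal (\<integral>\<^sup>+x. ennreal (- f x) \<partial>M)"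

text \<open>
  The choice of density is immaterial (lemma \<open>haar_entropy_eq\<close>), so the library's
  Radon-Nikodym derivative is used. Since \<open>ln 0 = 0\<close>, the convention \<open>0 * log 0 = 0\<close> is built in.
\<close>

definition haar_entropy :: "'g measure \<Rightarrow> 'b measure \<Rightarrow> ('b \<Rightarrow> 'g) \<Rightarrow> ereal" where
  "haar_entropy \<mu> M X =
     (if \<exists>f. distributed M \<mu> X f
      then let f = (\<lambda>x. enn2real (RN_deriv \<mu> (distr M \<mu> X) x))
           in - ext_integral \<mu> (\<lambda>x. f x * ln (f x))
      else - \<infinity>)"

definition rel_entropy :: "'a measure \<Rightarrow> 'a measure \<Rightarrow> ereal" where
  "rel_entropy P Q =
     (if absolutely_continuous Q P
      then ext_integral P (\<lambda>x. ln (enn2real (RN_deriv Q P x)))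
      else \<infinity>)"

definition nsinc :: "real \<Rightarrow> real" where
  "nsinc x = sin (pi * x) / (pi * x)"

definition rfun :: "real \<Rightarrow> real" where
  "rfun x = 1 - min (1/4)
     ((1 - (nsinc (exp (6 * x - 2)))\<^sup>2)\<^sup>2 /
      (8 + 16 * ((nsinc (exp (6 * x - 2)))\<^sup>2 / exp (6 * x - 2))))"

lemma ext_integral_cong_AE:
  assumes "AE x in M. f x = g x"
  shows "ext_integral M f = ext_integral M g"
proof -
  have "(\<integral>\<^sup>+x. ennreal (f x) \<partial>M) = (\<integral>\<^sup>+x. ennreal (g x) \<partial>M)"
    by (rule nn_integral_cong_AE) (use assms in auto)
  moreover have "(\<integral>\<^sup>+x. ennreal (- f x) \<partial>M) = (\<integral>\<^sup>+x. ennreal (- g x) \<partial>M)"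
    by (rule nn_integral_cong_AE) (use assms in auto)
  ultimately show ?thesis
    by (simp add: ext_integral_def)
qed

lemma haar_entropy_eq:
  assumes "prob_space \<mu>" and f: "distributed M \<mu> X (\<lambda>x. ennreal (f x))"
    and nonneg: "\<And>x. 0 \<le> f x"
  shows "haar_entropy \<mu> M X = - ext_integral \<mu> (\<lambda>x. f x * ln (f x))"
proof -
  interpret prob_space \<mu> by fact
  have "AE x in \<mu>. ennreal (f x) = RN_deriv \<mu> (distr M \<mu> X) x"
    using f by (intro RN_deriv_unique) (auto simp: distributed_def)
  then have "AE x in \<mu>. enn2real (RN_deriv \<mu> (distr M \<mu> X) x) = f x"
    by eventually_elim (metis enn2real_ennreal nonneg)
  then have "AE x in \<mu>.
      enn2real (RN_deriv \<mu> (distr M \<mu> X) x) * ln (enn2real (RN_deriv \<mu> (distr M \<mu> X) x))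
      = f x * ln (f x)"
    by eventually_elim simp
  from ext_integral_cong_AE[OF this] f show ?thesis
    by (auto simp: haar_entropy_def Let_def)
qed

lemma rel_entropy_haar:
  assumes "prob_space \<mu>" "prob_space M" and X: "X \<in> measurable M \<mu>"
  shows "rel_entropy (distr M \<mu> X) \<mu> = - haar_entropy \<mu> M X"
proof -
  interpret prob_space \<mu> by fact
  interpret M: prob_space M by fact
  let ?P = "distr M \<mu> X"
  let ?R = "RN_deriv \<mu> ?P"
  let ?r = "\<lambda>x. enn2real (?R x)"
  show ?thesis
  proof (cases "absolutely_continuous \<mu> ?P")
    case True
    have P: "density \<mu> ?R = ?P"
      using True by (intro density_RN_deriv) auto
    have "sigma_finite_measure ?P"
      using X by (intro prob_space_imp_sigma_finite M.prob_space_distr)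
    then have fin: "AE x in \<mu>. ?R x \<noteq> \<infinity>"
      using True by (intro RN_deriv_finite) auto
    have nn: "(\<integral>\<^sup>+x. ennreal (s * ln (?r x)) \<partial>?P) = (\<integral>\<^sup>+x. ennreal (s * (?r x * ln (?r x))) \<partial>\<mu>)"
      for s :: real
    proof -
      have "(\<integral>\<^sup>+x. ennreal (s * ln (?r x)) \<partial>?P) =
            (\<integral>\<^sup>+x. ennreal (s * ln (?r x)) \<partial>density \<mu> ?R)"
        by (simp only: P)
      also have "\<dots> = (\<integral>\<^sup>+x. ?R x * ennreal (s * ln (?r x)) \<partial>\<mu>)"
        by (rule nn_integral_density) simp_all
      also have "\<dots> = (\<integral>\<^sup>+x. ennreal (s * (?r x * ln (?r x))) \<partial>\<mu>)"
      proof (rule nn_integral_cong_AE)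
        show "AE x in \<mu>. ?R x * ennreal (s * ln (?r x)) = ennreal (s * (?r x * ln (?r x)))"
          using fin
        proof eventually_elim
          case (elim x)
          then have "?R x = ennreal (?r x)"
            by (simp add: less_top)
          then have "?R x * ennreal (s * ln (?r x)) = ennreal (?r x * (s * ln (?r x)))"
            by (metis ennreal_mult' enn2real_nonneg)
          then show ?case
            by (simp add: ac_simps)
        qed
      qed
      finally show ?thesis .
    qed
    have "distributed M \<mu> X ?R"
      using P X by (simp add: distributed_def)
    then have "\<exists>f. distributed M \<mu> X f" by blast
    with True nn[of 1] nn[of "-1"] show ?thesis
      by (simp add: rel_entropy_def haar_entropy_def ext_integral_def)
  next
    case False
    have "\<not> distributed M \<mu> X f" for f
    proof
      assume "distributed M \<mu> X f"
      then have "absolutely_continuous \<mu> ?P"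
        unfolding distributed_def by (metis absolutely_continuousI_density)
      with False show False ..
    qed
    with False show ?thesis
      by (simp add: rel_entropy_def haar_entropy_def)
  qed
qed

end

theory Submission
  imports Defs
begin

text \<open>
  It suffices to show \<open>H (p * W) \<le> rfun (h W) * H p\<close> for a density \<open>p\<close> and a law \<open>W\<close> of finite entropy
  \<open>h W\<close>, where \<open>H p = \<integral> p ln p\<close>. Put \<open>F = sqrt p\<close> and \<open>v = 1 - (\<integral> F)\<^sup>2\<close>.
  Pointwise, the loss \<open>H p - H (p * W)\<close> is at least \<open>\<integral> p * W - (F * W)\<^sup>2\<close>. If the density of \<open>W\<close> is
  at most \<open>T \<ge> 4\<close>, this is at least \<open>v / (16 T\<^sup>2)\<close>: the distance \<open>d a = norm (F (\<cdot> + a) - F)\<close> in L2 is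
  continuous, subadditive and at least \<open>sqrt (2 v)\<close> somewhere, so on a connected group a set of small
  \<open>d\<close>-diameter has many disjoint translates, hence small measure, and \<open>W\<close> cannot concentrate on it.
  This replaces the spectral gap obtained from Fourier coefficients. On the other hand
  \<open>H (p * W) \<le> 2 T v\<close> by comparison with the chi-square divergence, so \<open>H\<close> contracts by the factor
  \<open>1 / (1 + 1 / (32 T\<^sup>3))\<close>. A general \<open>W\<close> is a mixture with weights 5/8 and 3/8 of a law with density
  at most \<open>8/5 exp (1 - 3 h W)\<close>, by Markov's inequality, and another law, and \<open>H\<close> is convex.
\<close>

subsection \<open>Haar probability measures\<close>

text \<open>Of \<open>p\<close> it is only known that \<open>p ln p\<close> is integrable, so L2
  methods do not apply to \<open>p\<close> itself and its chi-square divergence may be infinite. Its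
  square root \<open>F\<close> always lies in L2, which is why everything is measured by the
  variance \<open>v\<close> of \<open>F\<close>: the entropy loss is bounded below by a multiple of
  \<open>v\<close>, and once a law of bounded density has smoothed \<open>p\<close>, the chi-square
  divergence of \<open>p * W\<close> is bounded above by a multiple of \<open>v\<close>.
  Connectedness is essential: the uniform law on a proper open subgroup has finite entropy and is
  unchanged by convolution with itself. The level \<open>u = exp (1 - 3 h)\<close> comes from
  Markov's inequality, which bounds the mass of \<open>W\<close> above it by
  \<open>(3/8 - h) / (1 - 3 h) \<le> 3/8\<close>. The constants are crude, but the room is ample:
  for large \<open>u\<close> the gain required by \<open>rfun\<close> is of order
  \<open>1 / u ^ 10\<close>, whereas the argument yields one of order
  \<open>1 / u ^ 3\<close>.\<close>

lemma compact_metrizable_countable_base: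
  assumes "compact (UNIV :: 'a::topological_space set)" "metrizable_space (euclidean :: 'a topology)"
  shows "\<exists>\<B>::'a set set. countable \<B> \<and> (\<forall>V\<in>\<B>. open V) \<and>
    (\<forall>U x. open U \<longrightarrow> x \<in> U \<longrightarrow> (\<exists>V\<in>\<B>. x \<in> V \<and> V \<subseteq> U))"
proof -
  obtain M d where "Metric_space M d" and eq: "(euclidean :: 'a topology) = Metric_space.mtopology M d"
    using assms(2) by (auto simp: metrizable_space_def)
  interpret Metric_space M d by fact
  have M: "M = UNIV"
    using topspace_mtopology eq by (metis topspace_euclidean)
  have op: "open U \<longleftrightarrow> openin mtopology U" for U :: "'a set"
    using eq by (metis open_openin)
  have "\<exists>K. finite K \<and> (\<Union>x\<in>K. mball x (inverse (Suc n))) = (UNIV :: 'a set)" for n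
  proof -
    have "x \<in> mball x (inverse (Suc n))" for x
      by (subst centre_in_mball_iff) (auto simp: M)
    then have "(UNIV :: 'a set) \<subseteq> (\<Union>x\<in>UNIV. mball x (inverse (Suc n)))"
      by blast
    then obtain K where "finite K" "(UNIV :: 'a set) \<subseteq> (\<Union>x\<in>K. mball x (inverse (Suc n)))"
      using compactE_image[OF assms(1), of UNIV "\<lambda>x. mball x (inverse (Suc n))"]
      by (auto simp: op)
    then show ?thesis by blast
  qed
  then obtain K where K: "\<And>n. finite (K n)" "\<And>n. (\<Union>x\<in>K n. mball x (inverse (Suc n))) = (UNIV :: 'a set)"
    by metis
  \<comment> \<open>At each scale finitely many balls cover the space. A covering ball of radius
    below \<open>r / 2\<close> that contains \<open>x\<close> lies in the ball of radius
    \<open>r\<close> about \<open>x\<close>, so these countably many balls form a base.\<close>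
  define \<B> where "\<B> = (\<Union>n. (\<lambda>x. mball x (inverse (Suc n))) ` K n)"
  have "countable \<B>"
    unfolding \<B>_def by (intro countable_UN[OF countableI_type] countable_image countable_finite K(1))
  moreover have "\<forall>V\<in>\<B>. open V"
    by (auto simp: \<B>_def op)
  moreover have "\<exists>V\<in>\<B>. x \<in> V \<and> V \<subseteq> U" if "open U" "x \<in> U" for U x
  proof -
    obtain r where r: "r > 0" "mball x r \<subseteq> U"
      using \<open>open U\<close> \<open>x \<in> U\<close> by (auto simp: op openin_mtopology)
    obtain n where n: "inverse (Suc n) < r / 2"
      using reals_Archimedean[of "r / 2"] r by auto
    obtain y where y: "y \<in> K n" "x \<in> mball y (inverse (Suc n))"
      using K(2)[of n] by blast
    have "mball y (inverse (Suc n)) \<subseteq> mball x r"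
    proof
      fix z assume "z \<in> mball y (inverse (Suc n))"
      then have "d y z < r / 2" "d y x < r / 2"
        using y n by auto
      then show "z \<in> mball x r"
        using triangle[of x y z] commute[of x y] by (subst in_mball) (simp add: M)
    qed
    then have "mball y (inverse (Suc n)) \<subseteq> U"
      using r(2) by (rule subset_trans)
    moreover have "mball y (inverse (Suc n)) \<in> \<B>"
      using y(1) unfolding \<B>_def by blast
    ultimately show ?thesis
      using y(2) by blast
  qed
  ultimately show ?thesis by blast
qed

text \<open>The countable base is what compactness and metrizability supply. It makes addition
  jointly Borel measurable and allows limits at \<open>0\<close> to be tested on sequences. It is
  spelled out because the metric is a property of the topology here, not part of the type class of
  \<open>'g\<close>.\<close>

locale haar_group =
  fixes \<mu> :: "'g::topological_ab_group_add measure"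
  assumes countable_base: "\<exists>\<B>::'g set set. countable \<B> \<and> (\<forall>V\<in>\<B>. open V) \<and>
      (\<forall>U x. open U \<longrightarrow> x \<in> U \<longrightarrow> (\<exists>V\<in>\<B>. x \<in> V \<and> V \<subseteq> U))"
    and haar: "haar_prob \<mu>"

sublocale haar_group \<subseteq> prob_space \<mu>
  using haar by (simp add: haar_prob_def)

context haar_group
begin

lemma sets_haar [simp, measurable_cong]: "sets \<mu> = sets borel"
  using haar by (simp add: haar_prob_def)

lemma space_haar [simp]: "space \<mu> = UNIV"
  using sets_eq_imp_space_eq[OF sets_haar] by simp

lemma measurable_haar_iff: "measurable \<mu> N = measurable borel N" "measurable L \<mu> = measurable L borel"
  by (auto intro!: measurable_cong_sets)

section \<open>Measurability of the group operations\<close>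

lemma measurable_group_add [measurable (raw)]:
  fixes f g :: "'c \<Rightarrow> 'g"
  assumes "f \<in> borel_measurable N" "g \<in> borel_measurable N"
  shows "(\<lambda>x. f x + g x) \<in> borel_measurable N"
proof -
  obtain \<B> :: "'g set set" where \<B>: "countable \<B>" "\<And>V. V \<in> \<B> \<Longrightarrow> open V"
    "\<And>U x. open U \<Longrightarrow> x \<in> U \<Longrightarrow> \<exists>V\<in>\<B>. x \<in> V \<and> V \<subseteq> U"
    using countable_base by metis
  show ?thesis
  proof (rule borel_measurableI)
    fix U :: "'g set" assume "open U"
    define P where "P = {z :: 'g \<times> 'g. fst z + snd z \<in> U}"
    have "P = (\<lambda>z. fst z + snd z) -` U" by (auto simp: P_def)
    also have "open \<dots>"
      by (intro open_vimage \<open>open U\<close> continuous_intros)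
    finally have "open P" .
    \<comment> \<open>\<open>P\<close> is open in the product by continuity of addition; the
      countable base writes it as a countable union of rectangles, whose preimages under
      \<open>(f, g)\<close> are measurable.\<close>
    define \<C> where "\<C> = {(V1, V2). V1 \<in> \<B> \<and> V2 \<in> \<B> \<and> V1 \<times> V2 \<subseteq> P}"
    have "countable \<C>"
      by (rule countable_subset[of _ "\<B> \<times> \<B>"]) (use \<B>(1) in \<open>auto simp: \<C>_def\<close>)
    have "(\<lambda>x. f x + g x) -` U \<inter> space N =
        (\<Union>(V1, V2)\<in>\<C>. (f -` V1 \<inter> space N) \<inter> (g -` V2 \<inter> space N))" (is "?L = ?R")
    proof
      show "?R \<subseteq> ?L" by (auto simp: \<C>_def P_def)
      show "?L \<subseteq> ?R"
      proof
        fix x assume x: "x \<in> ?L"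
        then have "(f x, g x) \<in> P" by (simp add: P_def)
        then obtain A B where AB: "open A" "open B" "(f x, g x) \<in> A \<times> B" "A \<times> B \<subseteq> P"
          using \<open>open P\<close> by (elim open_prod_elim)
        obtain V1 V2 where "V1 \<in> \<B>" "f x \<in> V1" "V1 \<subseteq> A" "V2 \<in> \<B>" "g x \<in> V2" "V2 \<subseteq> B"
          using \<B>(3) AB by (metis mem_Times_iff fst_conv snd_conv)
        with AB x show "x \<in> ?R" by (force simp: \<C>_def)
      qed
    qed
    also have "\<dots> \<in> sets N"
      using \<open>countable \<C>\<close>
      by (rule sets.countable_UN') (use \<B>(2) assms in \<open>auto simp: \<C>_def intro!: sets.Int measurable_sets borel_open\<close>)
    finally show "(\<lambda>x. f x + g x) -` U \<inter> space N \<in> sets N" .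
  qed
qed

lemma measurable_group_uminus [measurable (raw)]:
  fixes f :: "'c \<Rightarrow> 'g"
  assumes "f \<in> borel_measurable N"
  shows "(\<lambda>x. - f x) \<in> borel_measurable N"
proof -
  have "(uminus :: 'g \<Rightarrow> 'g) \<in> borel_measurable borel"
    by (intro borel_measurable_continuous_onI continuous_on_minus continuous_on_id)
  from measurable_compose[OF assms this] show ?thesis .
qed

lemma measurable_group_diff [measurable (raw)]:
  fixes f g :: "'c \<Rightarrow> 'g"
  assumes "f \<in> borel_measurable N" "g \<in> borel_measurable N"
  shows "(\<lambda>x. f x - g x) \<in> borel_measurable N"
  using measurable_group_add[OF assms(1) measurable_group_uminus[OF assms(2)]] by simp

lemma measurable_group_sum:
  fixes f :: "'i \<Rightarrow> 'c \<Rightarrow> 'g"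
  assumes "\<And>i. i \<in> I \<Longrightarrow> f i \<in> borel_measurable N"
  shows "(\<lambda>x. \<Sum>i\<in>I. f i x) \<in> borel_measurable N"
  using assms by (induction I rule: infinite_finite_induct) (auto intro: measurable_group_add)

text \<open>Dominated convergence speaks of sequences, while the continuity argument below needs the
  filter \<open>nhds 0\<close>. If the limit failed, a bad point chosen in the intersection of the
  first \<open>n\<close> base sets around \<open>0\<close> would give a sequence that tends to
  \<open>0\<close> along which \<open>f\<close> stays outside a neighbourhood of
  \<open>L\<close>.\<close>

lemma tendsto_0_sequentially:
  fixes f :: "'g \<Rightarrow> real"
  assumes "\<And>X. X \<longlonglongrightarrow> 0 \<Longrightarrow> (\<lambda>n. f (X n)) \<longlonglongrightarrow> L"
  shows "(f \<longlongrightarrow> L) (nhds 0)"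
proof (rule ccontr)
  assume "\<not> (f \<longlongrightarrow> L) (nhds 0)"
  then obtain S where S: "open S" "L \<in> S" and nev: "\<not> eventually (\<lambda>x. f x \<in> S) (nhds 0)"
    by (auto simp: tendsto_def)
  obtain \<B> :: "'g set set" where \<B>: "countable \<B>" "\<And>V. V \<in> \<B> \<Longrightarrow> open V"
    "\<And>U x. open U \<Longrightarrow> x \<in> U \<Longrightarrow> \<exists>V\<in>\<B>. x \<in> V \<and> V \<subseteq> U"
    using countable_base by metis
  define \<C> where "\<C> = {V \<in> \<B>. 0 \<in> V}"
  have "\<C> \<noteq> {}"
    using \<B>(3)[of UNIV 0] by (auto simp: \<C>_def)
  have "countable \<C>"
    using \<B>(1) by (simp add: \<C>_def)
  define V where "V = from_nat_into \<C>"
  have V: "range V = \<C>"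
    unfolding V_def by (rule range_from_nat_into) fact+
  have V': "open (V n)" "0 \<in> V n" for n
  proof -
    have "V n \<in> \<C>" using V by auto
    then show "open (V n)" "0 \<in> V n" using \<B>(2) by (auto simp: \<C>_def)
  qed
  define N where "N n = (\<Inter>i\<le>n. V i)" for n
  have "\<exists>x. x \<in> N n \<and> f x \<notin> S" for n
  proof (rule ccontr)
    assume "\<not> ?thesis"
    then have "\<forall>x\<in>N n. f x \<in> S" by blast
    moreover have "open (N n)" "0 \<in> N n"
      using V' by (auto simp: N_def intro!: open_INT)
    ultimately show False
      using nev by (auto simp: eventually_nhds)
  qed
  then obtain X where X: "\<And>n. X n \<in> N n" "\<And>n. f (X n) \<notin> S"
    by metis
  have "X \<longlonglongrightarrow> 0"
  proof (rule topological_tendstoI)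
    fix U :: "'g set" assume "open U" "0 \<in> U"
    then obtain B where "B \<in> \<C>" "B \<subseteq> U"
      using \<B>(3)[OF \<open>open U\<close> \<open>0 \<in> U\<close>] by (auto simp: \<C>_def)
    then obtain i where i: "V i \<subseteq> U"
      using V by auto
    have "X n \<in> U" if "n \<ge> i" for n
      using X(1)[of n] i that by (auto simp: N_def)
    then show "eventually (\<lambda>n. X n \<in> U) sequentially"
      by (auto simp: eventually_sequentially)
  qed
  from assms[OF this] have "eventually (\<lambda>n. f (X n) \<in> S) sequentially"
    using S by (auto simp: tendsto_def)
  with X(2) show False by simp
qed

section \<open>Invariance under translation and reflection\<close>

lemma distr_add: "distr \<mu> \<mu> (\<lambda>y. y + a) = \<mu>"
proof (rule measure_eqI)
  fix A assume "A \<in> sets (distr \<mu> \<mu> (\<lambda>y. y + a))"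
  then have A: "A \<in> sets borel" by simp
  \<comment> \<open>\<open>haar_prob\<close> speaks of images under left translation,
    \<open>distr\<close> of preimages.\<close>
  have img: "(\<lambda>y. y + a) -` A = (\<lambda>x. - a + x) ` A"
  proof (intro set_eqI iffI)
    fix y assume "y \<in> (\<lambda>y. y + a) -` A"
    then show "y \<in> (\<lambda>x. - a + x) ` A" by (intro image_eqI[of _ _ "y + a"]) auto
  qed auto
  have "emeasure \<mu> ((\<lambda>y. y + a) -` A) = emeasure \<mu> A"
    unfolding img using haar A unfolding haar_prob_def by blast
  with A show "emeasure (distr \<mu> \<mu> (\<lambda>y. y + a)) A = emeasure \<mu> A"
    by (subst emeasure_distr) auto
qed simp

lemma nn_integral_add:
  assumes [measurable]: "f \<in> borel_measurable borel"
  shows "(\<integral>\<^sup>+y. f (y + a) \<partial>\<mu>) = (\<integral>\<^sup>+y. f y \<partial>\<mu>)"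
proof -
  have "(\<integral>\<^sup>+y. f (y + a) \<partial>\<mu>) = (\<integral>\<^sup>+y. f y \<partial>distr \<mu> \<mu> (\<lambda>y. y + a))"
    by (subst nn_integral_distr) auto
  then show ?thesis by (simp add: distr_add)
qed

lemma nn_integral_sub:
  assumes "f \<in> borel_measurable borel"
  shows "(\<integral>\<^sup>+y. f (y - a) \<partial>\<mu>) = (\<integral>\<^sup>+y. f y \<partial>\<mu>)"
  using nn_integral_add[OF assms, of "- a"] by simp

lemma integrable_add_iff:
  fixes f :: "'g \<Rightarrow> real"
  assumes [measurable]: "f \<in> borel_measurable borel"
  shows "integrable \<mu> (\<lambda>y. f (y + a)) \<longleftrightarrow> integrable \<mu> f"
proof -
  have "integrable \<mu> (\<lambda>y. f (y + a)) \<longleftrightarrow> integrable (distr \<mu> \<mu> (\<lambda>y. y + a)) f"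
    by (subst integrable_distr_eq) auto
  then show ?thesis by (simp add: distr_add)
qed

lemma integral_add:
  fixes f :: "'g \<Rightarrow> real"
  assumes [measurable]: "f \<in> borel_measurable borel"
  shows "(\<integral>y. f (y + a) \<partial>\<mu>) = (\<integral>y. f y \<partial>\<mu>)"
proof -
  have "(\<integral>y. f (y + a) \<partial>\<mu>) = (\<integral>y. f y \<partial>distr \<mu> \<mu> (\<lambda>y. y + a))"
    by (subst integral_distr) auto
  then show ?thesis by (simp add: distr_add)
qed

lemma integrable_sub_iff:
  fixes f :: "'g \<Rightarrow> real"
  assumes "f \<in> borel_measurable borel"
  shows "integrable \<mu> (\<lambda>y. f (y - a)) \<longleftrightarrow> integrable \<mu> f"
  using integrable_add_iff[OF assms, of "- a"] by simp

lemma integral_sub: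
  fixes f :: "'g \<Rightarrow> real"
  assumes "f \<in> borel_measurable borel"
  shows "(\<integral>y. f (y - a) \<partial>\<mu>) = (\<integral>y. f y \<partial>\<mu>)"
  using integral_add[OF assms, of "- a"] by simp

text \<open>Integrate \<open>f (x - y)\<close> over both variables. For fixed \<open>y\<close>,
  translation in \<open>x\<close> gives the integral of \<open>f\<close>; for fixed
  \<open>x\<close>, translation in \<open>y\<close> gives that of \<open>f (- y)\<close>. Since the
  total mass is 1, Tonelli equates the two.\<close>

lemma nn_integral_reflect:
  assumes [measurable]: "f \<in> borel_measurable borel"
  shows "(\<integral>\<^sup>+y. f (- y) \<partial>\<mu>) = (\<integral>\<^sup>+y. f y \<partial>\<mu>)"
proof -
  interpret P: pair_sigma_finite \<mu> \<mu> ..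
  have "(\<integral>\<^sup>+x. (\<integral>\<^sup>+y. f (x - y) \<partial>\<mu>) \<partial>\<mu>) = (\<integral>\<^sup>+y. (\<integral>\<^sup>+x. f (x - y) \<partial>\<mu>) \<partial>\<mu>)"
    by (rule P.Fubini'[symmetric]) simp
  moreover have "(\<integral>\<^sup>+y. f (x - y) \<partial>\<mu>) = (\<integral>\<^sup>+y. f (- y) \<partial>\<mu>)" for x
    using nn_integral_sub[of "\<lambda>y. f (- y)" x] by simp
  ultimately show ?thesis
    using emeasure_space_1 by (simp add: nn_integral_sub)
qed

lemma distr_reflect: "distr \<mu> \<mu> (\<lambda>y. x - y) = \<mu>"
proof (rule measure_eqI)
  fix A assume "A \<in> sets (distr \<mu> \<mu> (\<lambda>y. x - y))"
  then have A [measurable]: "A \<in> sets borel" by simp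
  have "emeasure (distr \<mu> \<mu> (\<lambda>y. x - y)) A = (\<integral>\<^sup>+y. indicator A y \<partial>distr \<mu> \<mu> (\<lambda>y. x - y))"
    by simp
  also have "\<dots> = (\<integral>\<^sup>+y. indicator A (x - y) \<partial>\<mu>)"
    by (subst nn_integral_distr) auto
  also have "\<dots> = (\<integral>\<^sup>+y. indicator A (- y) \<partial>\<mu>)"
    using nn_integral_sub[of "\<lambda>y. indicator A (- y)" x] by simp
  also have "\<dots> = (\<integral>\<^sup>+y. indicator A y \<partial>\<mu>)"
    by (rule nn_integral_reflect) simp
  finally show "emeasure (distr \<mu> \<mu> (\<lambda>y. x - y)) A = emeasure \<mu> A"
    by simp
qed simp

lemma integrable_reflect_iff:
  fixes f :: "'g \<Rightarrow> real"
  assumes [measurable]: "f \<in> borel_measurable borel"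
  shows "integrable \<mu> (\<lambda>y. f (x - y)) \<longleftrightarrow> integrable \<mu> f"
proof -
  have "integrable \<mu> (\<lambda>y. f (x - y)) \<longleftrightarrow> integrable (distr \<mu> \<mu> (\<lambda>y. x - y)) f"
    by (subst integrable_distr_eq) auto
  then show ?thesis by (simp add: distr_reflect)
qed

lemma integral_reflect:
  fixes f :: "'g \<Rightarrow> real"
  assumes [measurable]: "f \<in> borel_measurable borel"
  shows "(\<integral>y. f (x - y) \<partial>\<mu>) = (\<integral>y. f y \<partial>\<mu>)"
proof -
  have "(\<integral>y. f (x - y) \<partial>\<mu>) = (\<integral>y. f y \<partial>distr \<mu> \<mu> (\<lambda>y. x - y))"
    by (subst integral_distr) auto
  then show ?thesis by (simp add: distr_reflect)
qed

end

subsection \<open>Entropy and L2 inequalities\<close>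

text \<open>The logarithm bound \<open>ln (a / g) \<le> 2 (sqrt (a / g) - 1)\<close> turns the entropy deficit into a variance.\<close>

lemma xlnx_ge_sqrt:
  fixes g a :: real
  assumes "0 \<le> g" "0 < a"
  shows "g * ln a + 2 * g - 2 * sqrt a * sqrt g \<le> g * ln g"
proof (cases "g = 0")
  case False
  with assms have g: "g > 0" by simp
  have "ln (sqrt (a / g)) \<le> sqrt (a / g) - 1"
    using assms g by (intro ln_le_minus_one) simp
  then have "ln a - ln g \<le> 2 * (sqrt a / sqrt g) - 2"
    using assms g by (simp add: ln_sqrt ln_div real_sqrt_divide)
  then have "g * (ln a - ln g) \<le> g * (2 * (sqrt a / sqrt g) - 2)"
    using g by (intro mult_left_mono) auto
  moreover have gs: "g * (sqrt a / sqrt g) = sqrt a * sqrt g"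
    using g by (metis mult.commute real_div_sqrt less_imp_le times_divide_eq_left times_divide_eq_right)
  have "g * (2 * r - 2) = 2 * (g * r) - 2 * g" for r
    by (simp add: algebra_simps)
  from this[of "sqrt a / sqrt g"] have "g * (2 * (sqrt a / sqrt g) - 2) = 2 * sqrt a * sqrt g - 2 * g"
    unfolding gs by simp
  ultimately show ?thesis
    by (simp add: right_diff_distrib)
qed simp

text \<open>The left side is the tangent at \<open>c\<close> to the convex function
  \<open>t * ln t\<close>. It is used at \<open>c = 1\<close>, at the minimiser
  \<open>c = exp (- 1)\<close>, and at the mean of a two-point mixture.\<close>

lemma xlnx_ge_tangent:
  fixes a c :: real
  assumes "0 \<le> a" "0 < c"
  shows "a * ln c + a - c \<le> a * ln a"
proof (cases "a = 0")
  case False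
  with assms have a: "a > 0" by simp
  have "ln (c / a) \<le> c / a - 1"
    using a assms by (intro ln_le_minus_one) simp
  then have "a * (ln c - ln a) \<le> a * (c / a - 1)"
    using a assms by (intro mult_left_mono) (auto simp: ln_div)
  with a show ?thesis by (simp add: algebra_simps)
qed (use assms in simp)

lemma xlnx_ge: "t - 1 \<le> t * ln t" if "0 \<le> t" for t :: real
  using xlnx_ge_tangent[of t 1] that by simp

lemma integrable_sqrt:
  assumes "finite_measure M" "integrable M g" "\<And>x. 0 \<le> g x"
  shows "integrable M (\<lambda>x. sqrt (g x))"
proof -
  interpret finite_measure M by fact
  note [measurable] = borel_measurable_integrable[OF assms(2)]
  have sq: "sqrt t \<le> 1 + t" if "0 \<le> t" for t :: real
    using that by (intro real_le_lsqrt) (auto simp: power2_eq_square algebra_simps)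
  show ?thesis
  proof (rule Bochner_Integration.integrable_bound)
    show "integrable M (\<lambda>x. 1 + g x)"
      using assms(2) by simp
    have "norm (sqrt (g x)) \<le> norm (1 + g x)" for x
      using sq[of "g x"] assms(3)[of x] by (simp del: real_sqrt_le_iff)
    then show "AE x in M. norm (sqrt (g x)) \<le> norm (1 + g x)" by simp
  qed simp
qed

lemma integrable_square_diff:
  fixes f g :: "'c \<Rightarrow> real"
  assumes [measurable]: "f \<in> borel_measurable N" "g \<in> borel_measurable N"
    and "integrable N (\<lambda>y. (f y)\<^sup>2)" "integrable N (\<lambda>y. (g y)\<^sup>2)"
  shows "integrable N (\<lambda>y. (f y - g y)\<^sup>2)"
proof (rule Bochner_Integration.integrable_bound)
  show "integrable N (\<lambda>y. 2 * (f y)\<^sup>2 + 2 * (g y)\<^sup>2)" using assms by simp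
  have "(a - b)\<^sup>2 \<le> 2 * a\<^sup>2 + 2 * b\<^sup>2" for a b :: real
    using zero_le_power2[of "a + b"] by (simp add: power2_sum power2_diff)
  then show "AE y in N. norm ((f y - g y)\<^sup>2) \<le> norm (2 * (f y)\<^sup>2 + 2 * (g y)\<^sup>2)"
    by simp
qed simp

lemma (in prob_space) integral_square_le:
  fixes f :: "'a \<Rightarrow> real"
  assumes "integrable M f" "integrable M (\<lambda>x. (f x)\<^sup>2)"
  shows "(expectation f)\<^sup>2 \<le> expectation (\<lambda>x. (f x)\<^sup>2)"
  using variance_eq[OF assms] variance_positive[of f] by simp

lemma (in prob_space) integral_square_diff:
  fixes f :: "'a \<Rightarrow> real"
  assumes "integrable M f" "integrable M (\<lambda>x. (f x)\<^sup>2)"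
  shows "expectation (\<lambda>x. (f x - c)\<^sup>2) = expectation (\<lambda>x. (f x)\<^sup>2) - 2 * c * expectation f + c\<^sup>2"
proof -
  have "expectation (\<lambda>x. (f x - c)\<^sup>2) = expectation (\<lambda>x. (f x)\<^sup>2 - 2 * c * f x + c\<^sup>2)"
    by (intro Bochner_Integration.integral_cong) (auto simp: power2_eq_square algebra_simps)
  also have "\<dots> = expectation (\<lambda>x. (f x)\<^sup>2) - 2 * c * expectation f + c\<^sup>2"
    using assms by (simp add: prob_space)
  finally show ?thesis .
qed

text \<open>A quantitative Jensen inequality. With \<open>A\<close> the mean of \<open>g\<close> and
  \<open>E\<close> the mean of \<open>sqrt g\<close>, integrating \<open>xlnx_ge_sqrt\<close> at
  \<open>a = A\<close> leaves the surplus \<open>2 * A - 2 * sqrt A * E\<close>, which is the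
  variance \<open>A - E\<^sup>2\<close> of \<open>sqrt g\<close> plus the square
  \<open>(sqrt A - E)\<^sup>2\<close>.\<close>

lemma (in prob_space) entropy_deficit_ge_variance:
  assumes g0: "\<And>x. 0 \<le> g x" and g: "integrable M g" and l: "integrable M (\<lambda>x. g x * ln (g x))"
  shows "expectation g * ln (expectation g) + (expectation g - (expectation (\<lambda>x. sqrt (g x)))\<^sup>2)
    \<le> expectation (\<lambda>x. g x * ln (g x))"
proof -
  define A where "A = expectation g"
  define E where "E = expectation (\<lambda>x. sqrt (g x))"
  have s: "integrable M (\<lambda>x. sqrt (g x))"
    using finite_measure_axioms g g0 by (rule integrable_sqrt)
  have "A \<ge> 0" unfolding A_def by (intro Bochner_Integration.integral_nonneg g0)
  show ?thesis
  proof (cases "A = 0")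
    case True
    then have "AE x in M. g x = 0"
      using integral_nonneg_eq_0_iff_AE[OF g] g0 by (auto simp: A_def)
    then have "AE x in M. g x * ln (g x) = 0" by eventually_elim simp
    then have "expectation (\<lambda>x. g x * ln (g x)) = expectation (\<lambda>x. 0)"
      using l by (intro integral_cong_AE) auto
    with True show ?thesis by (simp add: A_def[symmetric])
  next
    case False
    with \<open>A \<ge> 0\<close> have A: "A > 0" by simp
    have "A * ln A + 2 * A - 2 * sqrt A * E = expectation (\<lambda>x. g x * ln A + 2 * g x - 2 * sqrt A * sqrt (g x))"
      using g s by (simp add: A_def E_def)
    also have "\<dots> \<le> expectation (\<lambda>x. g x * ln (g x))"
      by (intro integral_mono l Bochner_Integration.integrable_add Bochner_Integration.integrable_diff
          integrable_mult_left integrable_mult_right g s xlnx_ge_sqrt g0 A)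
    finally have "A * ln A + 2 * A - 2 * sqrt A * E \<le> expectation (\<lambda>x. g x * ln (g x))" .
    moreover have "0 \<le> (sqrt A - E)\<^sup>2" by simp
    then have "2 * sqrt A * E \<le> A + E\<^sup>2"
      using A by (simp add: power2_diff)
    ultimately show ?thesis
      by (simp add: A_def E_def)
  qed
qed

section \<open>Cauchy-Schwarz and Minkowski inequalities\<close>

lemma Cauchy_Schwarz_integral:
  fixes f g :: "'a \<Rightarrow> real"
  assumes [measurable]: "f \<in> borel_measurable M" "g \<in> borel_measurable M"
    and f: "integrable M (\<lambda>x. (f x)\<^sup>2)" and g: "integrable M (\<lambda>x. (g x)\<^sup>2)"
  shows "integrable M (\<lambda>x. f x * g x)"
    and "(\<integral>x. f x * g x \<partial>M) \<le> sqrt (\<integral>x. (f x)\<^sup>2 \<partial>M) * sqrt (\<integral>x. (g x)\<^sup>2 \<partial>M)"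
proof -
  show fg: "integrable M (\<lambda>x. f x * g x)"
  proof (rule Bochner_Integration.integrable_bound)
    show "integrable M (\<lambda>x. (f x)\<^sup>2 + (g x)\<^sup>2)" using f g by simp
    have "\<bar>a * b\<bar> \<le> a\<^sup>2 + b\<^sup>2" for a b :: real
    proof -
      have "2 * (\<bar>a\<bar> * \<bar>b\<bar>) \<le> a\<^sup>2 + b\<^sup>2"
        using sum_squares_bound[of "\<bar>a\<bar>" "\<bar>b\<bar>"] by simp
      moreover have "0 \<le> \<bar>a\<bar> * \<bar>b\<bar>" by simp
      ultimately show ?thesis unfolding abs_mult by linarith
    qed
    then show "AE x in M. norm (f x * g x) \<le> norm ((f x)\<^sup>2 + (g x)\<^sup>2)" by auto
  qed simp
  define a where "a = sqrt (\<integral>x. (f x)\<^sup>2 \<partial>M)"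
  define b where "b = sqrt (\<integral>x. (g x)\<^sup>2 \<partial>M)"
  have ab: "0 \<le> a" "0 \<le> b" "a\<^sup>2 = (\<integral>x. (f x)\<^sup>2 \<partial>M)" "b\<^sup>2 = (\<integral>x. (g x)\<^sup>2 \<partial>M)"
    by (auto simp: a_def b_def)
  have "(\<integral>x. f x * g x \<partial>M) \<le> a * b"
  proof (cases "a = 0 \<or> b = 0")
    case True
    then have "(AE x in M. (f x)\<^sup>2 = 0) \<or> (AE x in M. (g x)\<^sup>2 = 0)"
      using integral_nonneg_eq_0_iff_AE[OF f] integral_nonneg_eq_0_iff_AE[OF g] ab by auto
    then have "AE x in M. f x * g x = 0" by auto
    then have "(\<integral>x. f x * g x \<partial>M) = (\<integral>x. 0 \<partial>M)"
      by (intro integral_cong_AE) auto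
    with ab show ?thesis by simp
  next
    case False
    \<comment> \<open>Weighting each function by the norm of the other makes both squares contribute
      \<open>a\<^sup>2 * b\<^sup>2\<close>. The factor \<open>2 * (a * b)\<close> is cancelled at
      the end, so vanishing norms had to be treated first.\<close>
    have "0 \<le> (\<integral>x. (b * f x - a * g x)\<^sup>2 \<partial>M)" by (intro Bochner_Integration.integral_nonneg) simp
    also have "\<dots> = (\<integral>x. b\<^sup>2 * (f x)\<^sup>2 - 2 * (a * b) * (f x * g x) + a\<^sup>2 * (g x)\<^sup>2 \<partial>M)"
      by (intro Bochner_Integration.integral_cong) (auto simp: power2_eq_square algebra_simps)
    also have "\<dots> = b\<^sup>2 * a\<^sup>2 - 2 * (a * b) * (\<integral>x. f x * g x \<partial>M) + a\<^sup>2 * b\<^sup>2"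
      using f g fg by (simp add: ab(3,4))
    also have "\<dots> = 2 * (a * b) * (a * b - (\<integral>x. f x * g x \<partial>M))"
      by (simp add: power2_eq_square algebra_simps)
    finally have "0 \<le> 2 * (a * b) * (a * b - (\<integral>x. f x * g x \<partial>M))" .
    moreover have "0 < 2 * (a * b)"
      using False ab by (simp add: less_le)
    ultimately have "0 \<le> a * b - (\<integral>x. f x * g x \<partial>M)"
      by (simp only: zero_le_mult_iff) linarith
    then show ?thesis by simp
  qed
  then show "(\<integral>x. f x * g x \<partial>M) \<le> sqrt (\<integral>x. (f x)\<^sup>2 \<partial>M) * sqrt (\<integral>x. (g x)\<^sup>2 \<partial>M)"
    by (simp add: a_def b_def)
qed

lemma Minkowski_integral:
  fixes f g :: "'a \<Rightarrow> real"
  assumes [measurable]: "f \<in> borel_measurable M" "g \<in> borel_measurable M"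
    and f: "integrable M (\<lambda>x. (f x)\<^sup>2)" and g: "integrable M (\<lambda>x. (g x)\<^sup>2)"
  shows "sqrt (\<integral>x. (f x + g x)\<^sup>2 \<partial>M) \<le> sqrt (\<integral>x. (f x)\<^sup>2 \<partial>M) + sqrt (\<integral>x. (g x)\<^sup>2 \<partial>M)"
proof (rule real_le_lsqrt)
  have "(\<integral>x. (f x + g x)\<^sup>2 \<partial>M) = (\<integral>x. (f x)\<^sup>2 + 2 * (f x * g x) + (g x)\<^sup>2 \<partial>M)"
    by (intro Bochner_Integration.integral_cong) (auto simp: power2_eq_square algebra_simps)
  also have "\<dots> = (\<integral>x. (f x)\<^sup>2 \<partial>M) + 2 * (\<integral>x. f x * g x \<partial>M) + (\<integral>x. (g x)\<^sup>2 \<partial>M)"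
    using f g Cauchy_Schwarz_integral(1)[OF assms] by simp
  also have "\<dots> \<le> (sqrt (\<integral>x. (f x)\<^sup>2 \<partial>M) + sqrt (\<integral>x. (g x)\<^sup>2 \<partial>M))\<^sup>2"
    using Cauchy_Schwarz_integral(2)[OF assms] by (simp add: power2_sum)
  finally show "(\<integral>x. (f x + g x)\<^sup>2 \<partial>M) \<le> (sqrt (\<integral>x. (f x)\<^sup>2 \<partial>M) + sqrt (\<integral>x. (g x)\<^sup>2 \<partial>M))\<^sup>2" .
qed simp_all

subsection \<open>Continuity of translation in L1\<close>

context haar_group
begin

lemma borel_measurable_integrable_borel:
  "integrable \<mu> (f :: 'g \<Rightarrow> real) \<Longrightarrow> f \<in> borel_measurable borel"
  using borel_measurable_integrable[of \<mu> f] by (simp add: measurable_haar_iff)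

text \<open>Closed sets are an intersection-stable generator of the Borel sets, so a Dynkin
  induction suffices. A point outside a closed set stays outside under small shifts, and invariance
  of the measure shows that as much mass leaves the set as enters it. A disjoint union is split into
  finitely many pieces and a tail of small measure.\<close>

lemma translation_tendsto_indicator:
  fixes X :: "nat \<Rightarrow> 'g"
  assumes X: "X \<longlonglongrightarrow> 0" and A: "A \<in> sets borel"
  shows "(\<lambda>n. \<integral>y. \<bar>indicator A (y + X n) - indicator A y\<bar> \<partial>\<mu>) \<longlonglongrightarrow> (0 :: real)"
proof -
  have int: "integrable \<mu> (indicator B :: 'g \<Rightarrow> real)" if "B \<in> sets borel" for B
    using that by (simp add: integrable_real_indicator emeasure_eq_measure)
  have int': "integrable \<mu> (\<lambda>y. indicator B (y + a) :: real)" if "B \<in> sets borel" for B a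
    using integrable_add_iff[of "indicator B" a] int[OF that] that by simp
  have "Int_stable (Collect (closed :: 'g set \<Rightarrow> bool))"
    by (auto simp: Int_stable_def)
  moreover have "Collect (closed :: 'g set \<Rightarrow> bool) \<subseteq> Pow UNIV" by simp
  moreover have "A \<in> sigma_sets UNIV (Collect closed)"
    using A by (simp add: borel_eq_closed)
  ultimately show ?thesis
  proof (induction A rule: sigma_sets_induct_disjoint)
    case empty
    show "(\<lambda>n. \<integral>y. \<bar>indicator {} (y + X n) - indicator {} y\<bar> \<partial>\<mu>) \<longlonglongrightarrow> (0 :: real)"
      by simp
  next
    fix K :: "'g set" assume "K \<in> Collect closed"
    then have "closed K" and [measurable]: "K \<in> sets borel" by auto
    \<comment> \<open>Pointwise the absolute difference is twice the entering part plus
      \<open>indicator K y - indicator K (y + X n)\<close>, and the latter integrates to 0. Only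
      points outside \<open>K\<close> then matter, and for them closedness applies.\<close>
    have "(\<integral>y. \<bar>indicator K (y + X n) - indicator K y\<bar> \<partial>\<mu> :: real) =
        2 * (\<integral>y. indicator K (y + X n) * (1 - indicator K y) \<partial>\<mu>)" for n
    proof -
      have i: "integrable \<mu> (\<lambda>y. indicator K (y + X n) * (1 - indicator K y) :: real)"
        by (rule Bochner_Integration.integrable_bound[OF int'[of K "X n"]])
          (auto simp: indicator_def)
      have "(\<integral>y. \<bar>indicator K (y + X n) - indicator K y\<bar> \<partial>\<mu> :: real) =
          (\<integral>y. 2 * (indicator K (y + X n) * (1 - indicator K y)) + indicator K y - indicator K (y + X n) \<partial>\<mu>)"
        by (intro Bochner_Integration.integral_cong) (auto simp: indicator_def)
      also have "\<dots> = 2 * (\<integral>y. indicator K (y + X n) * (1 - indicator K y) \<partial>\<mu>)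
          + (\<integral>y. indicator K y \<partial>\<mu>) - (\<integral>y. indicator K (y + X n) \<partial>\<mu>)"
        using i int[of K] int'[of K "X n"] by (simp del: Bochner_Integration.integral_indicator)
      also have "(\<integral>y. indicator K (y + X n) \<partial>\<mu>) = (\<integral>y. indicator K y \<partial>\<mu> :: real)"
        by (rule integral_add) simp
      finally show ?thesis by simp
    qed
    moreover have "(\<lambda>n. \<integral>y. indicator K (y + X n) * (1 - indicator K y) \<partial>\<mu>) \<longlonglongrightarrow> (\<integral>y. (0::real) \<partial>\<mu>)"
    proof (rule integral_dominated_convergence[where w = "\<lambda>_. 1"])
      show "AE y in \<mu>. (\<lambda>n. indicator K (y + X n) * (1 - indicator K y)) \<longlonglongrightarrow> (0::real)"
      proof (rule AE_I2)
        fix y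
        show "(\<lambda>n. indicator K (y + X n) * (1 - indicator K y)) \<longlonglongrightarrow> (0::real)"
        proof (cases "y \<in> K")
          case False
          have "(\<lambda>n. y + X n) \<longlonglongrightarrow> y + 0"
            by (intro tendsto_intros X)
          then have "eventually (\<lambda>n. y + X n \<in> - K) sequentially"
            using \<open>closed K\<close> False by (intro topological_tendstoD) auto
          then have "eventually (\<lambda>n. indicator K (y + X n) * (1 - indicator K y) = (0::real)) sequentially"
            by eventually_elim simp
          then show ?thesis by (rule tendsto_eventually)
        qed simp
      qed
    qed (auto simp: indicator_def)
    ultimately show "(\<lambda>n. \<integral>y. \<bar>indicator K (y + X n) - indicator K y\<bar> \<partial>\<mu>) \<longlonglongrightarrow> (0 :: real)"
      using tendsto_mult_right_zero[of _ sequentially "2::real"] by simp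
  next
    fix B :: "'g set"
    assume "(\<lambda>n. \<integral>y. \<bar>indicator B (y + X n) - indicator B y\<bar> \<partial>\<mu>) \<longlonglongrightarrow> (0 :: real)"
    moreover have "(\<integral>y. \<bar>indicator (UNIV - B) (y + X n) - indicator (UNIV - B) y\<bar> \<partial>\<mu>)
        = (\<integral>y. \<bar>indicator B (y + X n) - indicator B y\<bar> \<partial>\<mu> :: real)" for n
      by (intro Bochner_Integration.integral_cong) (auto simp: indicator_def)
    ultimately show "(\<lambda>n. \<integral>y. \<bar>indicator (UNIV - B) (y + X n) - indicator (UNIV - B) y\<bar> \<partial>\<mu>) \<longlonglongrightarrow> (0 :: real)"
      by simp
  next
    fix B :: "nat \<Rightarrow> 'g set"
    assume disj: "disjoint_family B" and B: "range B \<subseteq> sigma_sets UNIV (Collect closed)"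
      and IH: "\<And>i. (\<lambda>n. \<integral>y. \<bar>indicator (B i) (y + X n) - indicator (B i) y\<bar> \<partial>\<mu>) \<longlonglongrightarrow> (0 :: real)"
    have [measurable]: "B i \<in> sets borel" for i
      using B by (auto simp: borel_eq_closed)
    have dj: "B i \<inter> B j = {}" if "i \<noteq> j" for i j
      using disj that unfolding disjoint_family_on_def by simp
    define U where "U = (\<Union>i. B i)"
    define V where "V N = (\<Union>i\<in>{N..}. B i)" for N
    have [measurable]: "U \<in> sets borel" "V N \<in> sets borel" for N
      by (auto simp: U_def V_def)
    define S where "S A n = (\<integral>y. \<bar>indicator A (y + X n) - indicator A y\<bar> \<partial>\<mu> :: real)" for A n
    have Si: "integrable \<mu> (\<lambda>y. \<bar>indicator A (y + X n) - indicator A y\<bar> :: real)"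
      if "A \<in> sets borel" for A n
      using int[OF that] int'[OF that, of "X n"] by (intro integrable_abs Bochner_Integration.integrable_diff)
    have meas: "(\<lambda>N. measure \<mu> (V N)) \<longlonglongrightarrow> 0"
    proof -
      have "(\<lambda>N. measure \<mu> (V N)) \<longlonglongrightarrow> measure \<mu> (\<Inter>N. V N)"
        by (rule finite_Lim_measure_decseq) (force simp: decseq_def V_def)+
      moreover have "(\<Inter>N. V N) = {}"
      proof -
        have False if "y \<in> (\<Inter>N. V N)" for y
        proof -
          from that have "y \<in> V 0" by blast
          then obtain i where i: "y \<in> B i" by (auto simp: V_def)
          have "y \<in> V (Suc i)" using that by blast
          then obtain j where "j \<ge> Suc i" "y \<in> B j" by (auto simp: V_def)
          with i dj[of i j] show False by auto
        qed
        then show ?thesis by blast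
      qed
      ultimately show ?thesis by simp
    qed
    have ind: "indicat_real U y = (\<Sum>i<N. indicat_real (B i) y) + (indicat_real (V N) y :: real)" for y N
    proof -
      have "indicat_real U y = indicat_real (\<Union>i<N. B i) y + (indicat_real (V N) y :: real)"
      proof -
        have un: "{..<N} \<union> {N..} = UNIV" by auto
        have "U = (\<Union>i<N. B i) \<union> V N"
          unfolding U_def V_def UN_Un[symmetric] un by simp
        moreover have "(\<Union>i<N. B i) \<inter> V N = {}"
        proof (rule equals0I)
          fix y assume "y \<in> (\<Union>i<N. B i) \<inter> V N"
          then obtain i j where "i < N" "y \<in> B i" "N \<le> j" "y \<in> B j" by (auto simp: V_def)
          with dj[of i j] show False by auto
        qed
        ultimately show ?thesis
          by (auto simp: indicator_def)
      qed
      also have "indicat_real (\<Union>i<N. B i) y = (\<Sum>i<N. indicat_real (B i) y :: real)"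
        by (rule indicator_UN_disjoint) (use disj in \<open>auto simp: disjoint_family_on_def\<close>)
      finally show ?thesis .
    qed
    \<comment> \<open>The tail contributes at most twice its measure, uniformly in \<open>n\<close>;
      hence \<open>N\<close> can be fixed before \<open>n\<close> tends to infinity.\<close>
    have bound: "S U n \<le> (\<Sum>i<N. S (B i) n) + 2 * measure \<mu> (V N)" for n N
    proof -
      have "S U n \<le> (\<integral>y. (\<Sum>i<N. \<bar>indicat_real (B i) (y + X n) - indicat_real (B i) y\<bar>)
          + (indicat_real (V N) (y + X n) + indicat_real (V N) y) \<partial>\<mu>)"
        unfolding S_def
      proof (rule integral_mono)
        fix y
        have "\<bar>indicat_real U (y + X n) - indicat_real U y\<bar> =
          \<bar>(\<Sum>i<N. indicat_real (B i) (y + X n) - indicat_real (B i) y) + (indicat_real (V N) (y + X n) - indicat_real (V N) y)\<bar>"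
          unfolding ind[of _ N] by (simp add: sum_subtractf)
        also have "\<dots> \<le> \<bar>\<Sum>i<N. indicat_real (B i) (y + X n) - indicat_real (B i) y\<bar> +
          \<bar>indicat_real (V N) (y + X n) - indicat_real (V N) y\<bar>"
          by (rule abs_triangle_ineq)
        also have "\<dots> \<le> (\<Sum>i<N. \<bar>indicat_real (B i) (y + X n) - indicat_real (B i) y\<bar>) +
          (indicat_real (V N) (y + X n) + indicat_real (V N) y)"
          by (intro add_mono sum_abs) (auto simp: indicator_def)
        finally show "\<bar>indicat_real U (y + X n) - indicat_real U y\<bar> \<le>
          (\<Sum>i<N. \<bar>indicat_real (B i) (y + X n) - indicat_real (B i) y\<bar>) +
          (indicat_real (V N) (y + X n) + indicat_real (V N) y :: real)" .
      qed (intro Si Bochner_Integration.integrable_add Bochner_Integration.integrable_sum int int'; simp)+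
      also have "\<dots> = (\<Sum>i<N. S (B i) n) + ((\<integral>y. indicat_real (V N) (y + X n) \<partial>\<mu>) + (\<integral>y. indicat_real (V N) y \<partial>\<mu>))"
        unfolding S_def
        by (subst Bochner_Integration.integral_add,
            (intro Si Bochner_Integration.integrable_add Bochner_Integration.integrable_sum int int'; simp)+,
            subst Bochner_Integration.integral_sum, (intro Si; simp),
            subst Bochner_Integration.integral_add, (intro int int'; simp)+, rule refl)
      also have "(\<integral>y. indicat_real (V N) (y + X n) \<partial>\<mu>) = (\<integral>y. indicat_real (V N) y \<partial>\<mu> :: real)"
        by (rule integral_add) simp
      finally show ?thesis by simp
    qed
    have "S U \<longlonglongrightarrow> 0"
    proof (rule LIMSEQ_I)
      fix e :: real assume "e > 0"
      obtain N where N: "measure \<mu> (V N) < e / 4"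
        using order_tendstoD(2)[OF meas, of "e / 4"] \<open>e > 0\<close> by (auto simp: eventually_sequentially)
      have "(\<lambda>n. \<Sum>i<N. S (B i) n) \<longlonglongrightarrow> (\<Sum>i<N. 0)"
        unfolding S_def by (intro tendsto_sum IH)
      then have "eventually (\<lambda>n. (\<Sum>i<N. S (B i) n) < e / 2) sequentially"
        using \<open>e > 0\<close> by (intro order_tendstoD(2)) auto
      then obtain n0 where n0: "\<And>n. n \<ge> n0 \<Longrightarrow> (\<Sum>i<N. S (B i) n) < e / 2"
        by (auto simp: eventually_sequentially)
      have "norm (S U n - 0) < e" if "n \<ge> n0" for n
      proof -
        have "S U n \<ge> 0" unfolding S_def by (intro Bochner_Integration.integral_nonneg) simp
        with bound[of n N] N n0[OF that] show ?thesis by simp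
      qed
      then show "\<exists>n0. \<forall>n\<ge>n0. norm (S U n - 0) < e" by blast
    qed
    then show "(\<lambda>n. \<integral>y. \<bar>indicator (\<Union>i. B i) (y + X n) - indicator (\<Union>i. B i) y\<bar> \<partial>\<mu>) \<longlonglongrightarrow> (0 :: real)"
      by (simp add: S_def[abs_def] U_def)
  qed
qed

text \<open>Approximation by simple functions in L1. The error of an approximant is the same before
  and after the shift, because the measure is invariant, so it is paid twice, independently of
  \<open>n\<close>.\<close>

lemma translation_tendsto_sequentially:
  fixes f :: "'g \<Rightarrow> real"
  assumes f: "integrable \<mu> f" and X: "X \<longlonglongrightarrow> 0"
  shows "(\<lambda>n. \<integral>y. \<bar>f (y + X n) - f y\<bar> \<partial>\<mu>) \<longlonglongrightarrow> 0"
  using f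
proof (induction rule: integrable_induct)
  case (base A c)
  then have "(\<lambda>n. (\<integral>y. \<bar>indicator A (y + X n) - indicator A y\<bar> \<partial>\<mu>) * \<bar>c\<bar>) \<longlonglongrightarrow> 0"
    using translation_tendsto_indicator[OF X, of A] by (intro tendsto_mult_left_zero) simp
  moreover have "(\<integral>y. \<bar>indicator A (y + X n) *\<^sub>R c - indicator A y *\<^sub>R c\<bar> \<partial>\<mu>)
      = (\<integral>y. \<bar>indicator A (y + X n) - indicator A y\<bar> \<partial>\<mu>) * \<bar>c\<bar>" for n
    by (subst integral_mult_left_zero[symmetric], intro Bochner_Integration.integral_cong)
      (auto simp: abs_mult[symmetric] algebra_simps)
  ultimately show ?case by simp
next
  case (add f g)
  note fm = borel_measurable_integrable_borel[OF add.hyps(1)]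
  note gm = borel_measurable_integrable_borel[OF add.hyps(2)]
  have fi: "integrable \<mu> (\<lambda>y. f (y + X n))" "integrable \<mu> (\<lambda>y. g (y + X n))" for n
    using integrable_add_iff[OF fm] integrable_add_iff[OF gm] add.hyps by auto
  have i: "integrable \<mu> (\<lambda>y. \<bar>f (y + X n) - f y\<bar>)" "integrable \<mu> (\<lambda>y. \<bar>g (y + X n) - g y\<bar>)" for n
    using fi add.hyps by auto
  show ?case
  proof (rule tendsto_sandwich[OF _ _ tendsto_const])
    show "(\<lambda>n. (\<integral>y. \<bar>f (y + X n) - f y\<bar> \<partial>\<mu>) + (\<integral>y. \<bar>g (y + X n) - g y\<bar> \<partial>\<mu>)) \<longlonglongrightarrow> 0"
      using tendsto_add[OF add.IH(1) add.IH(2)] by simp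
    show "eventually (\<lambda>n. (\<integral>y. \<bar>f (y + X n) + g (y + X n) - (f y + g y)\<bar> \<partial>\<mu>)
      \<le> (\<integral>y. \<bar>f (y + X n) - f y\<bar> \<partial>\<mu>) + (\<integral>y. \<bar>g (y + X n) - g y\<bar> \<partial>\<mu>)) sequentially"
    proof (rule always_eventually, rule allI)
      fix n
      have "(\<integral>y. \<bar>f (y + X n) + g (y + X n) - (f y + g y)\<bar> \<partial>\<mu>)
          \<le> (\<integral>y. \<bar>f (y + X n) - f y\<bar> + \<bar>g (y + X n) - g y\<bar> \<partial>\<mu>)"
        using fi[of n] add.hyps by (intro integral_mono) auto
      also have "\<dots> = (\<integral>y. \<bar>f (y + X n) - f y\<bar> \<partial>\<mu>) + (\<integral>y. \<bar>g (y + X n) - g y\<bar> \<partial>\<mu>)"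
        by (rule Bochner_Integration.integral_add[OF i])
      finally show "(\<integral>y. \<bar>f (y + X n) + g (y + X n) - (f y + g y)\<bar> \<partial>\<mu>)
        \<le> (\<integral>y. \<bar>f (y + X n) - f y\<bar> \<partial>\<mu>) + (\<integral>y. \<bar>g (y + X n) - g y\<bar> \<partial>\<mu>)" .
    qed
  qed (auto intro!: always_eventually Bochner_Integration.integral_nonneg)
next
  case (lim f s)
  note sm = borel_measurable_integrable_borel[OF lim.hyps(1)]
  note fm = borel_measurable_integrable_borel[OF lim.hyps(4)]
  have [measurable]: "s i \<in> borel_measurable borel" "f \<in> borel_measurable borel" for i
    using sm fm by auto
  have "(\<lambda>i. \<integral>y. \<bar>f y - s i y\<bar> \<partial>\<mu>) \<longlonglongrightarrow> (\<integral>y. 0 \<partial>\<mu>)"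
  \<comment> \<open>\<open>integrable_induct\<close> provides approximants with
    \<open>norm (s i y) \<le> 2 * norm (f y)\<close>, whence the factor 3.\<close>
  proof (rule integral_dominated_convergence[where w = "\<lambda>y. 3 * \<bar>f y\<bar>"])
    show "AE y in \<mu>. (\<lambda>i. \<bar>f y - s i y\<bar>) \<longlonglongrightarrow> 0"
    proof (rule AE_I2)
      fix y
      have "(\<lambda>i. \<bar>f y - s i y\<bar>) \<longlonglongrightarrow> \<bar>f y - f y\<bar>"
        by (intro tendsto_intros lim.hyps(2)) simp
      then show "(\<lambda>i. \<bar>f y - s i y\<bar>) \<longlonglongrightarrow> 0" by simp
    qed
    show "AE y in \<mu>. norm \<bar>f y - s i y\<bar> \<le> 3 * \<bar>f y\<bar>" for i
    proof (rule AE_I2)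
      fix y show "norm \<bar>f y - s i y\<bar> \<le> 3 * \<bar>f y\<bar>"
        using lim.hyps(3)[of y i] by simp
    qed
    show "integrable \<mu> (\<lambda>y. 3 * \<bar>f y\<bar>)" using lim.hyps(4) by simp
  qed auto
  then have L: "(\<lambda>i. \<integral>y. \<bar>f y - s i y\<bar> \<partial>\<mu>) \<longlonglongrightarrow> 0" by simp
  have sh: "integrable \<mu> (\<lambda>y. f (y + X n))" "integrable \<mu> (\<lambda>y. s i (y + X n))" for n i
    using integrable_add_iff[OF fm] integrable_add_iff[OF sm] lim.hyps by auto
  show ?case
  proof (rule LIMSEQ_I)
    fix e :: real assume "e > 0"
    obtain i where i: "(\<integral>y. \<bar>f y - s i y\<bar> \<partial>\<mu>) < e / 4"
      using order_tendstoD(2)[OF L, of "e / 4"] \<open>e > 0\<close> by (auto simp: eventually_sequentially)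
    obtain n0 where n0: "\<And>n. n \<ge> n0 \<Longrightarrow> (\<integral>y. \<bar>s i (y + X n) - s i y\<bar> \<partial>\<mu>) < e / 2"
      using order_tendstoD(2)[OF lim.IH[of i], of "e / 2"] \<open>e > 0\<close> by (auto simp: eventually_sequentially)
    have "norm ((\<integral>y. \<bar>f (y + X n) - f y\<bar> \<partial>\<mu>) - 0) < e" if "n \<ge> n0" for n
    proof -
      have i1: "integrable \<mu> (\<lambda>y. \<bar>f (y + X n) - s i (y + X n)\<bar>)" "integrable \<mu> (\<lambda>y. \<bar>s i (y + X n) - s i y\<bar>)"
        "integrable \<mu> (\<lambda>y. \<bar>f y - s i y\<bar>)"
        using sh lim.hyps by auto
      have "(\<integral>y. \<bar>f (y + X n) - f y\<bar> \<partial>\<mu>) \<le>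
          (\<integral>y. \<bar>f (y + X n) - s i (y + X n)\<bar> + \<bar>s i (y + X n) - s i y\<bar> + \<bar>f y - s i y\<bar> \<partial>\<mu>)"
        using i1 sh lim.hyps(4) by (intro integral_mono) auto
      also have "\<dots> = (\<integral>y. \<bar>f (y + X n) - s i (y + X n)\<bar> \<partial>\<mu>) +
          (\<integral>y. \<bar>s i (y + X n) - s i y\<bar> \<partial>\<mu>) + (\<integral>y. \<bar>f y - s i y\<bar> \<partial>\<mu>)"
        using i1 by (simp del: integrable_abs_iff)
      also have "(\<integral>y. \<bar>f (y + X n) - s i (y + X n)\<bar> \<partial>\<mu>) = (\<integral>y. \<bar>f y - s i y\<bar> \<partial>\<mu>)"
        by (rule integral_add) simp
      finally have "(\<integral>y. \<bar>f (y + X n) - f y\<bar> \<partial>\<mu>) < e"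
        using i n0[OF that] by simp
      moreover have "(\<integral>y. \<bar>f (y + X n) - f y\<bar> \<partial>\<mu>) \<ge> 0" by (intro Bochner_Integration.integral_nonneg) simp
      ultimately show ?thesis by simp
    qed
    then show "\<exists>n0. \<forall>n\<ge>n0. norm ((\<integral>y. \<bar>f (y + X n) - f y\<bar> \<partial>\<mu>) - 0) < e" by blast
  qed
qed

lemma translation_tendsto:
  fixes f :: "'g \<Rightarrow> real"
  assumes f: "integrable \<mu> f"
  shows "((\<lambda>a. \<integral>y. \<bar>f (y + a) - f y\<bar> \<partial>\<mu>) \<longlongrightarrow> 0) (nhds 0)"
  by (rule tendsto_0_sequentially) (rule translation_tendsto_sequentially[OF f])

end

subsection \<open>The translation distance\<close>

context haar_group
begin

lemma haar_UNIV [simp]: "measure \<mu> UNIV = 1" "emeasure \<mu> UNIV = 1"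
  using prob_space emeasure_space_1 by simp_all

text \<open>For \<open>F = sqrt p\<close> this is, up to normalisation, the Hellinger distance
  between \<open>p\<close> and its translate. For square-integrable \<open>F\<close> it behaves like
  a pseudonorm on the group: it is symmetric, subadditive and vanishes at \<open>0\<close>.\<close>

definition shift_dist :: "('g \<Rightarrow> real) \<Rightarrow> 'g \<Rightarrow> real" where
  "shift_dist F a = sqrt (\<integral>y. (F (y + a) - F y)\<^sup>2 \<partial>\<mu>)"

lemma shift_dist_nonneg: "0 \<le> shift_dist F a"
  by (simp add: shift_dist_def Bochner_Integration.integral_nonneg)

lemma shift_dist_0: "shift_dist F 0 = 0"
  by (simp add: shift_dist_def)

lemma shift_dist_minus:
  assumes [measurable]: "F \<in> borel_measurable borel"
  shows "shift_dist F (- a) = shift_dist F a"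
proof -
  have "(\<integral>y. (F (y + - a) - F y)\<^sup>2 \<partial>\<mu>) = (\<integral>y. (F (y + a + - a) - F (y + a))\<^sup>2 \<partial>\<mu>)"
    by (rule integral_add[symmetric]) simp
  also have "\<dots> = (\<integral>y. (F (y + a) - F y)\<^sup>2 \<partial>\<mu>)"
    by (intro Bochner_Integration.integral_cong) (simp_all add: power2_commute)
  finally show ?thesis by (simp add: shift_dist_def)
qed

context
  fixes F :: "'g \<Rightarrow> real"
  assumes F [measurable]: "F \<in> borel_measurable borel"
    and F2: "integrable \<mu> (\<lambda>y. (F y)\<^sup>2)"
begin

lemma integrable_shift_square: "integrable \<mu> (\<lambda>y. (F (y + a))\<^sup>2)"
  using integrable_add_iff[of "\<lambda>y. (F y)\<^sup>2" a] F2 by simp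

lemma integrable_shift_dist: "integrable \<mu> (\<lambda>y. (F (y + a) - F (y + b))\<^sup>2)"
  by (intro integrable_square_diff integrable_shift_square) simp_all

lemma shift_dist_triangle: "shift_dist F (a + b) \<le> shift_dist F a + shift_dist F b"
proof -
  have "(\<integral>y. (F (y + b + a) - F (y + b))\<^sup>2 \<partial>\<mu>) = (\<integral>y. (F (y + a) - F y)\<^sup>2 \<partial>\<mu>)"
    by (rule integral_add) simp
  moreover have "sqrt (\<integral>y. ((F (y + b + a) - F (y + b)) + (F (y + b) - F y))\<^sup>2 \<partial>\<mu>) \<le>
      sqrt (\<integral>y. (F (y + b + a) - F (y + b))\<^sup>2 \<partial>\<mu>) + sqrt (\<integral>y. (F (y + b) - F y)\<^sup>2 \<partial>\<mu>)"
    using integrable_shift_dist[of "b + a" b] integrable_shift_dist[of b 0]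
    by (intro Minkowski_integral) (simp_all add: add.assoc)
  ultimately show ?thesis
    by (simp add: shift_dist_def ac_simps)
qed

lemma shift_dist_diff_le: "\<bar>shift_dist F a - shift_dist F b\<bar> \<le> shift_dist F (a - b)"
proof -
  have "shift_dist F a \<le> shift_dist F (a - b) + shift_dist F b"
    using shift_dist_triangle[of "a - b" b] by simp
  moreover have "shift_dist F b \<le> shift_dist F (b - a) + shift_dist F a"
    using shift_dist_triangle[of "b - a" a] by simp
  moreover have "shift_dist F (b - a) = shift_dist F (a - b)"
    using shift_dist_minus[OF F, of "a - b"] by simp
  ultimately show ?thesis by simp
qed

text \<open>By \<open>shift_dist_diff_le\<close>, continuity at \<open>a\<close> reduces to the
  limit at \<open>0\<close>, which is supplied later for square roots of integrable
  functions.\<close>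

lemma continuous_shift_dist:
  assumes "(shift_dist F \<longlongrightarrow> 0) (nhds 0)"
  shows "continuous_on UNIV (shift_dist F)"
  unfolding continuous_on_def
proof
  fix a :: 'g
  have "((\<lambda>b. b - a) \<longlongrightarrow> a - a) (at a)"
    using tendsto_add[OF tendsto_ident_at[of a UNIV] tendsto_const[of "- a"]] by simp
  then have "((\<lambda>b. shift_dist F (b - a)) \<longlongrightarrow> 0) (at a)"
    using filterlim_compose[OF assms, of "\<lambda>b. b - a" "at a"] by simp
  then have "((\<lambda>b. shift_dist F b - shift_dist F a) \<longlongrightarrow> 0) (at a)"
  proof (rule Lim_null_comparison[rotated])
    show "\<forall>\<^sub>F b in at a. norm (shift_dist F b - shift_dist F a) \<le> shift_dist F (b - a)"
      using shift_dist_diff_le by (intro always_eventually) simp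
  qed
  then show "(shift_dist F \<longlongrightarrow> shift_dist F a) (at a within UNIV)"
    by (simp add: LIM_zero_iff)
qed

text \<open>By connectedness \<open>shift_dist F\<close> takes the values \<open>0, t, 2t, \<dots>, (k - 1) t\<close>; the translates of
  \<open>S\<close> by such points are disjoint.\<close>

lemma measure_le_of_small_diameter:
  assumes conn: "connected (UNIV :: 'g set)" and lim: "(shift_dist F \<longlongrightarrow> 0) (nhds 0)"
    and S [measurable]: "S \<in> sets borel"
    and diam: "\<And>s s'. s \<in> S \<Longrightarrow> s' \<in> S \<Longrightarrow> shift_dist F (s' - s) < t"
    and t: "0 \<le> t" "real (k - 1) * t \<le> shift_dist F z"
  shows "real k * measure \<mu> S \<le> 1"
proof -
  have "\<exists>a. shift_dist F a = real i * t" if "i < k" for i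
  proof -
    have "connected (range (shift_dist F))"
      using conn by (rule connected_continuous_image[OF continuous_shift_dist[OF lim]])
    moreover have "0 \<in> range (shift_dist F)"
      by (rule range_eqI[of _ _ 0]) (simp add: shift_dist_0)
    moreover have "real i * t \<le> shift_dist F z"
    proof -
      have "real i * t \<le> real (k - 1) * t"
        using that t by (intro mult_right_mono) auto
      with t show ?thesis by simp
    qed
    ultimately have "real i * t \<in> range (shift_dist F)"
      using connectedD_interval[of "range (shift_dist F)" 0 "shift_dist F z" "real i * t"] t by simp
    then show ?thesis by (metis imageE)
  qed
  then obtain a where a: "\<And>i. i < k \<Longrightarrow> shift_dist F (a i) = real i * t"
    by metis
  define B where "B i = (\<lambda>y. y - a i) -` S" for i
  have B [measurable]: "B i \<in> sets borel" for i
  proof -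
    have "(\<lambda>y. y - a i) \<in> borel_measurable borel" by simp
    from measurable_sets[OF this S] show ?thesis by (simp add: B_def)
  qed
  have mB: "measure \<mu> (B i) = measure \<mu> S" for i
  proof -
    have "measure \<mu> S = measure (distr \<mu> \<mu> (\<lambda>y. y + - a i)) S"
      by (simp only: distr_add)
    also have "\<dots> = measure \<mu> ((\<lambda>y. y + - a i) -` S \<inter> space \<mu>)"
      by (rule measure_distr) simp_all
    finally show ?thesis by (simp add: B_def)
  qed
  have disj: "disjoint_family_on B {..<k}"
    unfolding disjoint_family_on_def
  proof (intro ballI impI)
    fix i j assume ij: "i \<in> {..<k}" "j \<in> {..<k}" "i \<noteq> j"
    show "B i \<inter> B j = {}"
    proof (rule equals0I)
      fix y assume "y \<in> B i \<inter> B j"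
      \<comment> \<open>A common point yields two elements of \<open>S\<close> whose difference is
        \<open>a i - a j\<close>, at distance less than \<open>t\<close>. But the distances of
        \<open>a i\<close> and \<open>a j\<close> are different multiples of \<open>t\<close>, so
        subadditivity forces at least \<open>t\<close>.\<close>
      then have "shift_dist F ((y - a j) - (y - a i)) < t"
        by (intro diam) (auto simp: B_def)
      then have "shift_dist F (a i - a j) < t" by simp
      with shift_dist_diff_le[of "a i" "a j"] have "\<bar>real i * t - real j * t\<bar> < t"
        using a ij by simp
      then have "\<bar>real i - real j\<bar> * t < t"
        using t by (simp add: left_diff_distrib[symmetric] abs_mult)
      moreover have "1 \<le> \<bar>real i - real j\<bar>" using ij by linarith
      then have "1 * t \<le> \<bar>real i - real j\<bar> * t" using t by (intro mult_right_mono) auto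
      ultimately show False by simp
    qed
  qed
  have "real k * measure \<mu> S = (\<Sum>i<k. measure \<mu> (B i))"
    by (simp add: mB)
  also have "\<dots> = measure \<mu> (\<Union>i<k. B i)"
    by (rule finite_measure_finite_Union[symmetric]) (use disj in auto)
  also have "\<dots> \<le> 1" by (rule prob_le_1)
  finally show ?thesis .
qed

text \<open>The Haar average of \<open>(shift_dist F a)\<^sup>2\<close> is exactly the left side:
  expanding the square leaves the autocorrelation \<open>c\<close>, whose integral is
  \<open>(\<integral>y. F y \<partial>\<mu>)\<^sup>2\<close> by Fubini and invariance. Not all
  values can lie strictly below their average.\<close>

lemma exists_shift_dist_ge: "\<exists>z. 2 * ((\<integral>y. (F y)\<^sup>2 \<partial>\<mu>) - (\<integral>y. F y \<partial>\<mu>)\<^sup>2) \<le> (shift_dist F z)\<^sup>2"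
proof (rule ccontr)
  assume "\<not> ?thesis"
  then have less: "(shift_dist F z)\<^sup>2 < 2 * ((\<integral>y. (F y)\<^sup>2 \<partial>\<mu>) - (\<integral>y. F y \<partial>\<mu>)\<^sup>2)" for z
    by (simp add: not_le)
  interpret P: pair_sigma_finite \<mu> \<mu> ..
  have i2: "integrable (\<mu> \<Otimes>\<^sub>M \<mu>) (\<lambda>w. (F (fst w))\<^sup>2)" "integrable (\<mu> \<Otimes>\<^sub>M \<mu>) (\<lambda>w. (F (snd w + fst w))\<^sup>2)"
  proof -
    show "integrable (\<mu> \<Otimes>\<^sub>M \<mu>) (\<lambda>w. (F (fst w))\<^sup>2)"
    proof (rule P.Fubini_integrable)
      show "AE x in \<mu>. integrable \<mu> (\<lambda>y. (F (fst (x, y)))\<^sup>2)" by simp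
      show "integrable \<mu> (\<lambda>x. \<integral>y. norm ((F (fst (x, y)))\<^sup>2) \<partial>\<mu>)" using F2 by (simp add: prob_space)
    qed simp
    show "integrable (\<mu> \<Otimes>\<^sub>M \<mu>) (\<lambda>w. (F (snd w + fst w))\<^sup>2)"
    proof (rule P.Fubini_integrable)
      show "AE x in \<mu>. integrable \<mu> (\<lambda>y. (F (snd (x, y) + fst (x, y)))\<^sup>2)"
        using integrable_shift_square by simp
      have "(\<integral>y. (F (y + x))\<^sup>2 \<partial>\<mu>) = (\<integral>y. (F y)\<^sup>2 \<partial>\<mu>)" for x
        by (rule integral_add) simp
      then show "integrable \<mu> (\<lambda>x. \<integral>y. norm ((F (snd (x, y) + fst (x, y)))\<^sup>2) \<partial>\<mu>)" by simp
    qed simp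
  qed
  have cross: "integrable (\<mu> \<Otimes>\<^sub>M \<mu>) (\<lambda>w. F (fst w) * F (snd w + fst w))"
    by (rule Cauchy_Schwarz_integral(1)[OF _ _ i2]) simp_all
  define c where "c a = (\<integral>y. F y * F (y + a) \<partial>\<mu>)" for a
  have cross': "integrable (\<mu> \<Otimes>\<^sub>M \<mu>) (\<lambda>(y, a). F y * F (y + a))"
    using cross by (simp add: split_beta' ac_simps)
  have ci: "integrable \<mu> c"
    using P.integrable_snd[OF cross'] by (simp add: c_def[abs_def])
  have "(\<integral>a. c a \<partial>\<mu>) = (\<integral>y. (\<integral>a. F y * F (y + a) \<partial>\<mu>) \<partial>\<mu>)"
    unfolding c_def by (rule P.Fubini_integral[OF cross'])
  also have "\<dots> = (\<integral>y. F y * (\<integral>a. F a \<partial>\<mu>) \<partial>\<mu>)"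
  proof (rule Bochner_Integration.integral_cong[OF refl])
    fix y
    show "(\<integral>a. F y * F (y + a) \<partial>\<mu>) = F y * (\<integral>a. F a \<partial>\<mu>)"
      using integral_add[OF F, of y] by (simp add: add.commute)
  qed
  finally have cI: "(\<integral>a. c a \<partial>\<mu>) = (\<integral>y. F y \<partial>\<mu>)\<^sup>2"
    by (simp add: power2_eq_square)
  have sq: "(shift_dist F a)\<^sup>2 = 2 * (\<integral>y. (F y)\<^sup>2 \<partial>\<mu>) - 2 * c a" for a
  proof -
    have "(shift_dist F a)\<^sup>2 = (\<integral>y. (F (y + a) - F y)\<^sup>2 \<partial>\<mu>)"
      by (simp add: shift_dist_def Bochner_Integration.integral_nonneg)
    also have "\<dots> = (\<integral>y. (F (y + a))\<^sup>2 + (F y)\<^sup>2 - 2 * (F y * F (y + a)) \<partial>\<mu>)"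
      by (intro Bochner_Integration.integral_cong) (auto simp: power2_eq_square algebra_simps)
    also have "\<dots> = (\<integral>y. (F (y + a))\<^sup>2 \<partial>\<mu>) + (\<integral>y. (F y)\<^sup>2 \<partial>\<mu>) - 2 * c a"
      using Cauchy_Schwarz_integral(1)[of F \<mu> "\<lambda>y. F (y + a)"] F2 integrable_shift_square[of a]
      by (simp add: c_def)
    also have "(\<integral>y. (F (y + a))\<^sup>2 \<partial>\<mu>) = (\<integral>y. (F y)\<^sup>2 \<partial>\<mu>)"
      by (rule integral_add) simp
    finally show ?thesis by simp
  qed
  have "(\<integral>a. (shift_dist F a)\<^sup>2 \<partial>\<mu>) < 2 * ((\<integral>y. (F y)\<^sup>2 \<partial>\<mu>) - (\<integral>y. F y \<partial>\<mu>)\<^sup>2)"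
    by (rule expectation_less) (use less ci in \<open>auto simp: sq\<close>)
  moreover have "(\<integral>a. (shift_dist F a)\<^sup>2 \<partial>\<mu>) = 2 * (\<integral>y. (F y)\<^sup>2 \<partial>\<mu>) - 2 * (\<integral>y. F y \<partial>\<mu>)\<^sup>2"
    unfolding sq using ci by (simp add: cI prob_space)
  ultimately show False by simp
qed

end

text \<open>The inequality \<open>(sqrt a - sqrt b)\<^sup>2 \<le> \<bar>a - b\<bar>\<close> bounds
  the L2 distance of the roots by the root of the L1 distance, so continuity of translation in L1 is
  enough.\<close>

lemma shift_dist_sqrt_tendsto:
  assumes p: "integrable \<mu> p" and p0: "\<And>y. 0 \<le> p y"
  shows "(shift_dist (\<lambda>y. sqrt (p y)) \<longlongrightarrow> 0) (nhds 0)"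
proof (rule tendsto_sandwich[OF _ _ tendsto_const])
  note pm [measurable] = borel_measurable_integrable_borel[OF p]
  have pa: "integrable \<mu> (\<lambda>y. p (y + a))" for a
    using p integrable_add_iff[OF pm] by simp
  have sq: "(sqrt a - sqrt b)\<^sup>2 \<le> \<bar>a - b\<bar>" if "0 \<le> a" "0 \<le> b" for a b
  proof -
    have "\<bar>sqrt a - sqrt b\<bar> * \<bar>sqrt a - sqrt b\<bar> \<le> \<bar>sqrt a - sqrt b\<bar> * \<bar>sqrt a + sqrt b\<bar>"
      using real_sqrt_ge_zero[OF that(1)] real_sqrt_ge_zero[OF that(2)]
      by (intro mult_left_mono) linarith+
    also have "\<dots> = \<bar>(sqrt a - sqrt b) * (sqrt a + sqrt b)\<bar>" by (simp add: abs_mult)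
    also have "(sqrt a - sqrt b) * (sqrt a + sqrt b) = a - b"
      using that by (simp add: algebra_simps)
    finally show ?thesis by (simp add: power2_eq_square)
  qed
  have "shift_dist (\<lambda>y. sqrt (p y)) a \<le> sqrt (\<integral>y. \<bar>p (y + a) - p y\<bar> \<partial>\<mu>)" for a
    unfolding shift_dist_def
  proof (intro real_sqrt_le_mono integral_mono)
    show "integrable \<mu> (\<lambda>y. (sqrt (p (y + a)) - sqrt (p y))\<^sup>2)"
      by (rule integrable_square_diff) (use p pa p0 in simp_all)
    show "integrable \<mu> (\<lambda>y. \<bar>p (y + a) - p y\<bar>)"
      using p pa by (intro integrable_abs) simp
    show "(sqrt (p (y + a)) - sqrt (p y))\<^sup>2 \<le> \<bar>p (y + a) - p y\<bar>" for y
      by (rule sq) (rule p0)+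
  qed
  then show "\<forall>\<^sub>F a in nhds 0. shift_dist (\<lambda>y. sqrt (p y)) a \<le> sqrt (\<integral>y. \<bar>p (y + a) - p y\<bar> \<partial>\<mu>)"
    by simp
  show "((\<lambda>a. sqrt (\<integral>y. \<bar>p (y + a) - p y\<bar> \<partial>\<mu>)) \<longlongrightarrow> 0) (nhds 0)"
    using tendsto_real_sqrt[OF translation_tendsto[OF p]] by simp
  show "\<forall>\<^sub>F a in nhds 0. 0 \<le> shift_dist (\<lambda>y. sqrt (p y)) a"
    by (simp add: shift_dist_nonneg)
qed

end

subsection \<open>Convolution with a probability measure\<close>

text \<open>One factor stays a measure, so that estimates at a fixed \<open>y\<close> are statements
  about expectations under \<open>W\<close>. Where \<open>f (y - x)\<close> is not integrable in
  \<open>x\<close> the value is 0; for integrable \<open>f\<close> such \<open>y\<close> form a null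
  set by \<open>AE_integrable_conv\<close>.\<close>

definition conv :: "'g measure \<Rightarrow> ('g::ab_group_add \<Rightarrow> real) \<Rightarrow> 'g \<Rightarrow> real" where
  "conv W f y = (\<integral>x. f (y - x) \<partial>W)"

locale haar_conv = haar_group \<mu> + W: prob_space W
  for \<mu> :: "'g::topological_ab_group_add measure" and W :: "'g measure" +
  assumes sets_W [simp, measurable_cong]: "sets W = sets borel"
begin

sublocale pair: pair_sigma_finite \<mu> W ..

lemma space_W [simp]: "space W = UNIV"
  using sets_eq_imp_space_eq[OF sets_W] by simp

lemma W_UNIV [simp]: "measure W UNIV = 1" "emeasure W UNIV = 1"
  using W.prob_space W.emeasure_space_1 by simp_all

lemma integrable_pair:
  assumes f: "integrable \<mu> f"
  shows "integrable (\<mu> \<Otimes>\<^sub>M W) (\<lambda>(y, x). f (y - x) :: real)"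
proof (rule integrableI_bounded)
  note fm [measurable] = borel_measurable_integrable_borel[OF f]
  show "(\<lambda>(y, x). f (y - x)) \<in> borel_measurable (\<mu> \<Otimes>\<^sub>M W)" by simp
  have "(\<integral>\<^sup>+z. ennreal (norm (case z of (y, x) \<Rightarrow> f (y - x))) \<partial>(\<mu> \<Otimes>\<^sub>M W)) =
      (\<integral>\<^sup>+x. (\<integral>\<^sup>+y. ennreal (norm (f (y - x))) \<partial>\<mu>) \<partial>W)"
    by (subst pair.nn_integral_snd[symmetric]) simp_all
  also have "\<dots> = (\<integral>\<^sup>+x. (\<integral>\<^sup>+y. ennreal (norm (f y)) \<partial>\<mu>) \<partial>W)"
    by (intro nn_integral_cong nn_integral_sub[of "\<lambda>y. ennreal (norm (f y))"]) simp
  also have "\<dots> = (\<integral>\<^sup>+y. ennreal (norm (f y)) \<partial>\<mu>)"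
    using W.emeasure_space_1 by simp
  also have "\<dots> < \<infinity>"
    using f by (simp add: integrable_iff_bounded)
  finally show "(\<integral>\<^sup>+z. ennreal (norm (case z of (y, x) \<Rightarrow> f (y - x))) \<partial>(\<mu> \<Otimes>\<^sub>M W)) < \<infinity>" .
qed

lemma AE_integrable_conv:
  assumes "integrable \<mu> f"
  shows "AE y in \<mu>. integrable W (\<lambda>x. f (y - x) :: real)"
  using pair.AE_integrable_fst'[OF integrable_pair[OF assms]] by simp

lemma integrable_conv: "integrable \<mu> f \<Longrightarrow> integrable \<mu> (conv W f)"
  using pair.integrable_fst'[OF integrable_pair, of f] by (simp add: conv_def[abs_def])

lemma integral_conv:
  assumes f: "integrable \<mu> f"
  shows "(\<integral>y. conv W f y \<partial>\<mu>) = (\<integral>y. f y \<partial>\<mu>)"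
proof -
  have "(\<integral>y. conv W f y \<partial>\<mu>) = (\<integral>x. (\<integral>y. f (y - x) \<partial>\<mu>) \<partial>W)"
    unfolding conv_def using pair.Fubini_integral[OF integrable_pair[OF f]] by simp
  also have "\<dots> = (\<integral>y. f y \<partial>\<mu>)"
    using W.prob_space by (simp add: integral_sub borel_measurable_integrable_borel[OF f])
  finally show ?thesis .
qed

lemma conv_nonneg: "(\<And>x. 0 \<le> f x) \<Longrightarrow> 0 \<le> conv W f y"
  by (simp add: conv_def Bochner_Integration.integral_nonneg)

lemma measurable_conv [measurable]:
  assumes [measurable]: "f \<in> borel_measurable borel"
  shows "conv W f \<in> borel_measurable borel"
  unfolding conv_def by measurable


text \<open>After Tonelli, for fixed \<open>y\<close> a translation moves the shift from the set
  \<open>A\<close> onto \<open>p\<close>. The measure \<open>W\<close> may be singular here.\<close>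

lemma density_conv:
  assumes p: "integrable \<mu> p" and p0: "\<And>y. 0 \<le> p y"
  shows "distr (density \<mu> (\<lambda>y. ennreal (p y)) \<Otimes>\<^sub>M W) \<mu> (\<lambda>(x, y). x + y) = density \<mu> (\<lambda>y. ennreal (conv W p y))"
proof (rule measure_eqI)
  note pm [measurable] = borel_measurable_integrable_borel[OF p]
  fix A assume "A \<in> sets (distr (density \<mu> (\<lambda>y. ennreal (p y)) \<Otimes>\<^sub>M W) \<mu> (\<lambda>(x, y). x + y))"
  then have A [measurable]: "A \<in> sets borel" by simp
  let ?P = "density \<mu> (\<lambda>y. ennreal (p y))"
  have "emeasure (distr (?P \<Otimes>\<^sub>M W) \<mu> (\<lambda>(x, y). x + y)) A = (\<integral>\<^sup>+z. indicator A z \<partial>distr (?P \<Otimes>\<^sub>M W) \<mu> (\<lambda>(x, y). x + y))"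
    by simp
  also have "\<dots> = (\<integral>\<^sup>+z. indicator A (fst z + snd z) \<partial>(?P \<Otimes>\<^sub>M W))"
    by (subst nn_integral_distr) (auto simp: case_prod_beta)
  also have "\<dots> = (\<integral>\<^sup>+x. (\<integral>\<^sup>+y. indicator A (x + y) \<partial>W) \<partial>?P)"
    by (subst W.nn_integral_fst[symmetric]) simp_all
  also have "\<dots> = (\<integral>\<^sup>+x. ennreal (p x) * (\<integral>\<^sup>+y. indicator A (x + y) \<partial>W) \<partial>\<mu>)"
    by (rule nn_integral_density) simp_all
  also have "\<dots> = (\<integral>\<^sup>+x. (\<integral>\<^sup>+y. ennreal (p x) * indicator A (x + y) \<partial>W) \<partial>\<mu>)"
    by (intro nn_integral_cong nn_integral_cmult[symmetric]) simp
  also have "\<dots> = (\<integral>\<^sup>+y. (\<integral>\<^sup>+x. ennreal (p x) * indicator A (x + y) \<partial>\<mu>) \<partial>W)"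
    by (rule pair.Fubini'[symmetric]) simp
  also have "\<dots> = (\<integral>\<^sup>+y. (\<integral>\<^sup>+x. ennreal (p (x - y)) * indicator A x \<partial>\<mu>) \<partial>W)"
    using nn_integral_add[of "\<lambda>x. ennreal (p (x - y)) * indicator A x" y for y] by simp
  also have "\<dots> = (\<integral>\<^sup>+x. (\<integral>\<^sup>+y. ennreal (p (x - y)) * indicator A x \<partial>W) \<partial>\<mu>)"
    by (rule pair.Fubini') simp
  also have "\<dots> = (\<integral>\<^sup>+x. ennreal (conv W p x) * indicator A x \<partial>\<mu>)"
  proof (rule nn_integral_cong_AE)
    show "AE x in \<mu>. (\<integral>\<^sup>+y. ennreal (p (x - y)) * indicator A x \<partial>W) = ennreal (conv W p x) * indicator A x"
      using AE_integrable_conv[OF p]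
    proof eventually_elim
      case (elim x)
      have "(\<integral>\<^sup>+y. ennreal (p (x - y)) \<partial>W) = ennreal (conv W p x)"
        unfolding conv_def by (rule nn_integral_eq_integral[OF elim]) (simp add: p0)
      then show ?case by (simp add: nn_integral_multc)
    qed
  qed
  also have "\<dots> = emeasure (density \<mu> (\<lambda>y. ennreal (conv W p y))) A"
    by (simp add: emeasure_density)
  finally show "emeasure (distr (?P \<Otimes>\<^sub>M W) \<mu> (\<lambda>(x, y). x + y)) A = \<dots>" .
qed simp

context
  fixes p :: "'g \<Rightarrow> real"
  assumes p: "integrable \<mu> p" and p0: "\<And>y. 0 \<le> p y"
begin

lemma measurable_density [measurable]: "p \<in> borel_measurable borel"
  by (rule borel_measurable_integrable_borel[OF p])

lemma integrable_sqrt_density: "integrable \<mu> (\<lambda>y. sqrt (p y))"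
  using finite_measure_axioms p p0 by (rule integrable_sqrt)

lemma conv_sqrt_square_le: "AE y in \<mu>. (conv W (\<lambda>y. sqrt (p y)) y)\<^sup>2 \<le> conv W p y"
  using AE_integrable_conv[OF p]
proof eventually_elim
  case (elim y)
  then have "integrable W (\<lambda>x. sqrt (p (y - x)))"
    using W.finite_measure_axioms by (intro integrable_sqrt) (auto simp: p0)
  with elim show ?case
    using W.integral_square_le[of "\<lambda>x. sqrt (p (y - x))"] by (simp add: conv_def p0)
qed

lemma integrable_conv_sqrt_square: "integrable \<mu> (\<lambda>y. (conv W (\<lambda>y. sqrt (p y)) y)\<^sup>2)"
proof (rule Bochner_Integration.integrable_bound[OF integrable_conv[OF p]])
  show "AE y in \<mu>. norm ((conv W (\<lambda>y. sqrt (p y)) y)\<^sup>2) \<le> norm (conv W p y)"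
    using conv_sqrt_square_le by eventually_elim simp
qed simp

text \<open>At almost every \<open>y\<close>, \<open>entropy_deficit_ge_variance\<close> applies to
  \<open>p (y - x)\<close> under \<open>W\<close>; integrating over \<open>y\<close> preserves the
  integral of \<open>p ln p\<close>. The loss term is the integrated \<open>W\<close>-variance of
  \<open>sqrt (p (y - x))\<close>.\<close>

lemma entropy_conv:
  assumes l: "integrable \<mu> (\<lambda>y. p y * ln (p y))"
  shows "integrable \<mu> (\<lambda>y. conv W p y * ln (conv W p y))" (is ?I)
    and "(\<integral>y. conv W p y * ln (conv W p y) \<partial>\<mu>) +
      (\<integral>y. conv W p y - (conv W (\<lambda>y. sqrt (p y)) y)\<^sup>2 \<partial>\<mu>) \<le> (\<integral>y. p y * ln (p y) \<partial>\<mu>)"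
proof -
  define q where "q = conv W p"
  define E where "E = conv W (\<lambda>y. sqrt (p y))"
  define L where "L = conv W (\<lambda>y. p y * ln (p y))"
  have [measurable]: "q \<in> borel_measurable borel" "E \<in> borel_measurable borel" "L \<in> borel_measurable borel"
    by (simp_all add: q_def E_def L_def)
  have q: "integrable \<mu> q" and E: "integrable \<mu> (\<lambda>y. (E y)\<^sup>2)" and L: "integrable \<mu> L"
    unfolding q_def E_def L_def by (intro integrable_conv integrable_conv_sqrt_square p l)+
  have q0: "0 \<le> q y" for y unfolding q_def by (rule conv_nonneg[OF p0])
  have Eq: "AE y in \<mu>. (E y)\<^sup>2 \<le> q y" unfolding q_def E_def by (rule conv_sqrt_square_le)
  have le: "AE y in \<mu>. q y * ln (q y) + (q y - (E y)\<^sup>2) \<le> L y"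
    using AE_integrable_conv[OF p] AE_integrable_conv[OF l]
  proof eventually_elim
    case (elim y)
    then show ?case
      using W.entropy_deficit_ge_variance[of "\<lambda>x. p (y - x)"] p0
      by (simp add: q_def E_def L_def conv_def)
  qed
  have i: "integrable \<mu> (\<lambda>y. q y * ln (q y))"
  proof (rule Bochner_Integration.integrable_bound)
    \<comment> \<open>The function \<open>q ln q\<close> lies between \<open>q - 1\<close> and
      \<open>L\<close>, since the variance term is nonnegative.\<close>
    show "integrable \<mu> (\<lambda>y. \<bar>L y\<bar> + q y + 1)" using L q by simp
    show "AE y in \<mu>. norm (q y * ln (q y)) \<le> norm (\<bar>L y\<bar> + q y + 1)"
      using le Eq
    proof eventually_elim
      case (elim y)
      with xlnx_ge[OF q0[of y]] q0[of y] show ?case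
        unfolding real_norm_def by linarith
    qed
  qed simp
  then show ?I by (simp add: q_def)
  have "(\<integral>y. q y * ln (q y) + (q y - (E y)\<^sup>2) \<partial>\<mu>) \<le> (\<integral>y. L y \<partial>\<mu>)"
    using le by (intro integral_mono_AE) (use i q E L in simp_all)
  moreover have "(\<integral>y. q y * ln (q y) + (q y - (E y)\<^sup>2) \<partial>\<mu>) = (\<integral>y. q y * ln (q y) \<partial>\<mu>) + (\<integral>y. q y - (E y)\<^sup>2 \<partial>\<mu>)"
    by (rule Bochner_Integration.integral_add) (use i q E in simp_all)
  moreover have "(\<integral>y. L y \<partial>\<mu>) = (\<integral>y. p y * ln (p y) \<partial>\<mu>)"
    unfolding L_def by (rule integral_conv[OF l])
  ultimately show "(\<integral>y. conv W p y * ln (conv W p y) \<partial>\<mu>) +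
      (\<integral>y. conv W p y - (conv W (\<lambda>y. sqrt (p y)) y)\<^sup>2 \<partial>\<mu>) \<le> (\<integral>y. p y * ln (p y) \<partial>\<mu>)"
    by (simp add: q_def E_def)
qed

text \<open>By Fubini the right side is the \<open>W\<close>-mean of \<open>D x\<close>, the squared
  L2 distance from the translate of \<open>F = sqrt p\<close> by \<open>x\<close> to the average
  translate \<open>E\<close>. Points with small \<open>D\<close> are pairwise close in
  \<open>shift_dist\<close>, hence form a set \<open>S\<close> of small Haar measure and of
  \<open>W\<close>-measure at most 1/2. The other half of the mass of \<open>W\<close> has
  \<open>D x \<ge> (t / 2)\<^sup>2\<close>, which gives \<open>t\<^sup>2 / 8\<close>.\<close>

lemma variance_gap:
  assumes conn: "connected (UNIV :: 'g set)" and p1: "(\<integral>y. p y \<partial>\<mu>) = 1" and T: "1 \<le> T"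
    and W: "\<And>A. A \<in> sets borel \<Longrightarrow> measure W A \<le> T * measure \<mu> A"
  shows "(1 - (\<integral>y. sqrt (p y) \<partial>\<mu>)\<^sup>2) / (16 * T\<^sup>2) \<le>
    (\<integral>y. conv W p y - (conv W (\<lambda>y. sqrt (p y)) y)\<^sup>2 \<partial>\<mu>)"
proof -
  define F where "F y = sqrt (p y)" for y
  have F [measurable]: "F \<in> borel_measurable borel" by (simp add: F_def[abs_def])
  have F2 [simp]: "(F y)\<^sup>2 = p y" for y by (simp add: F_def p0)
  define E where "E = conv W F"
  have [measurable]: "E \<in> borel_measurable borel" by (simp add: E_def)
  have E: "integrable \<mu> (\<lambda>y. (E y)\<^sup>2)"
    unfolding E_def F_def by (rule integrable_conv_sqrt_square)
  have Eq: "AE y in \<mu>. (E y)\<^sup>2 \<le> conv W p y" unfolding E_def F_def by (rule conv_sqrt_square_le)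
  define v where "v = 1 - (\<integral>y. F y \<partial>\<mu>)\<^sup>2"
  define G where "G = (\<integral>y. conv W p y - (E y)\<^sup>2 \<partial>\<mu>)"
  have "v / (16 * T\<^sup>2) \<le> G"
  proof (cases "v \<le> 0")
    case True
    then have "v / (16 * T\<^sup>2) \<le> 0" by (simp add: divide_nonpos_nonneg)
    also have "0 \<le> G" unfolding G_def
      using Eq by (intro integral_nonneg_AE) simp
    finally show ?thesis .
  next
    case False
    obtain z where z: "2 * v \<le> (shift_dist F z)\<^sup>2"
      using exists_shift_dist_ge[OF F] p by (auto simp: v_def p1)
    define R where "R = shift_dist F z"
    have R: "R > 0"
      using z False shift_dist_nonneg[of F z] by (auto simp: R_def less_le)
    \<comment> \<open>\<open>k \<ge> 2 * T\<close> makes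
      \<open>measure W S \<le> T / k \<le> 1 / 2\<close>, while \<open>k - 1 \<le> 2 * T\<close>
      keeps the spacing \<open>t\<close> at least \<open>R / (2 * T)\<close>. The hypothesis
      \<open>1 \<le> T\<close> ensures \<open>k \<ge> 2\<close>, so that \<open>t\<close> is a
      genuine quotient.\<close>
    define k where "k = nat \<lceil>2 * T\<rceil>"
    have k: "2 * T \<le> real k" "real (k - 1) \<le> 2 * T" "0 < real (k - 1)" "0 < real k"
    proof -
      have "2 * T \<le> of_int \<lceil>2 * T\<rceil>" "of_int \<lceil>2 * T\<rceil> < 2 * T + 1" by linarith+
      moreover have c: "2 \<le> \<lceil>2 * T\<rceil>" using T by linarith
      then have "real k = of_int \<lceil>2 * T\<rceil>" unfolding k_def by (intro of_nat_nat) linarith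
      moreover have "k \<ge> 2" using c unfolding k_def by linarith
      ultimately show "2 * T \<le> real k" "real (k - 1) \<le> 2 * T" "0 < real (k - 1)" "0 < real k"
        by (auto simp: of_nat_diff)
    qed
    define t where "t = R / real (k - 1)"
    have t: "0 < t" "real (k - 1) * t \<le> shift_dist F z"
      using R k by (auto simp: t_def R_def)
    define D where "D x = (\<integral>y. (F (y - x) - E y)\<^sup>2 \<partial>\<mu>)" for x
    have D [measurable]: "D \<in> borel_measurable borel"
      unfolding D_def by measurable
    have Fs: "integrable \<mu> (\<lambda>y. (F (y - x))\<^sup>2)" for x
      using integrable_sub_iff[OF measurable_density] p by simp
    \<comment> \<open>Radius \<open>t / 2\<close> about \<open>E\<close>: two members satisfy
      \<open>(shift_dist F (s' - s))\<^sup>2 \<le> 2 * D s + 2 * D s' < t\<^sup>2\<close>.\<close>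
    define S where "S = {x. D x < (t / 2)\<^sup>2}"
    have S [measurable]: "S \<in> sets borel" by (simp add: S_def)
    have diam: "shift_dist F (s' - s) < t" if "s \<in> S" "s' \<in> S" for s s'
    proof -
      have i: "integrable \<mu> (\<lambda>y. (F (y - x) - E y)\<^sup>2)" for x
        using Fs E by (intro integrable_square_diff) simp_all
      have "(shift_dist F (s' - s))\<^sup>2 = (\<integral>y. (F (y + (s' - s)) - F y)\<^sup>2 \<partial>\<mu>)"
        by (simp add: shift_dist_def Bochner_Integration.integral_nonneg)
      also have "\<dots> = (\<integral>y. (F (y - s' + (s' - s)) - F (y - s'))\<^sup>2 \<partial>\<mu>)"
        by (rule integral_sub[symmetric]) simp
      also have "\<dots> = (\<integral>y. (F (y - s) - F (y - s'))\<^sup>2 \<partial>\<mu>)"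
        by (simp add: algebra_simps)
      also have "\<dots> \<le> (\<integral>y. 2 * (F (y - s) - E y)\<^sup>2 + 2 * (F (y - s') - E y)\<^sup>2 \<partial>\<mu>)"
      proof (rule integral_mono)
        show "integrable \<mu> (\<lambda>y. (F (y - s) - F (y - s'))\<^sup>2)"
          using Fs by (intro integrable_square_diff) simp_all
        have "(a - b)\<^sup>2 \<le> 2 * (a - e)\<^sup>2 + 2 * (b - e)\<^sup>2" for a b e :: real
          using zero_le_power2[of "(a - e) + (b - e)"] by (simp add: power2_eq_square algebra_simps)
        then show "(F (y - s) - F (y - s'))\<^sup>2 \<le> 2 * (F (y - s) - E y)\<^sup>2 + 2 * (F (y - s') - E y)\<^sup>2" for y
          by simp
      qed (use i in simp)
      also have "\<dots> = 2 * D s + 2 * D s'" using i by (simp add: D_def)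
      also have "\<dots> < t\<^sup>2" using that by (simp add: S_def power_divide)
      finally show ?thesis by (rule power2_less_imp_less) (use t in simp)
    qed
    have "(shift_dist F \<longlongrightarrow> 0) (nhds 0)"
      unfolding F_def by (rule shift_dist_sqrt_tendsto[OF p p0])
    then have "real k * measure \<mu> S \<le> 1"
      by (intro measure_le_of_small_diameter[OF F _ conn _ S diam _ t(2)]) (use p t in simp_all)
    moreover have "2 * T * measure \<mu> S \<le> real k * measure \<mu> S"
      using k by (intro mult_right_mono) auto
    ultimately have WS: "measure W S \<le> 1 / 2"
      using W[OF S] by simp
    have int2: "integrable (\<mu> \<Otimes>\<^sub>M W) (\<lambda>(y, x). (F (y - x) - E y)\<^sup>2)"
    proof -
      have "integrable (\<mu> \<Otimes>\<^sub>M W) (\<lambda>w. (F (fst w - snd w) - E (fst w))\<^sup>2)"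
      proof (rule integrable_square_diff)
        show "integrable (\<mu> \<Otimes>\<^sub>M W) (\<lambda>w. (F (fst w - snd w))\<^sup>2)"
          using integrable_pair[OF p] by (simp add: split_beta')
        show "integrable (\<mu> \<Otimes>\<^sub>M W) (\<lambda>w. (E (fst w))\<^sup>2)"
        proof (rule pair.Fubini_integrable)
          show "integrable \<mu> (\<lambda>x. \<integral>y. norm ((E (fst (x, y)))\<^sup>2) \<partial>W)"
            using E W.prob_space by simp
        qed simp_all
      qed simp_all
      then show ?thesis by (simp add: split_beta')
    qed
    have DI: "integrable W D"
      using pair.integrable_snd[OF int2] by (simp add: D_def[abs_def])
    \<comment> \<open>For fixed \<open>y\<close>, \<open>E y\<close> is the mean of
      \<open>F (y - x)\<close> under \<open>W\<close>, so the inner integral after the exchange is a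
      variance.\<close>
    have "(\<integral>x. D x \<partial>W) = (\<integral>y. (\<integral>x. (F (y - x) - E y)\<^sup>2 \<partial>W) \<partial>\<mu>)"
      unfolding D_def by (rule pair.Fubini_integral[OF int2])
    also have "\<dots> = G"
      unfolding G_def
    proof (rule integral_cong_AE)
      show "AE y in \<mu>. (\<integral>x. (F (y - x) - E y)\<^sup>2 \<partial>W) = conv W p y - (E y)\<^sup>2"
        using AE_integrable_conv[OF p]
      proof eventually_elim
        case (elim y)
        have "integrable W (\<lambda>x. F (y - x))"
          unfolding F_def using W.finite_measure_axioms elim by (rule integrable_sqrt) (rule p0)
        then have "(\<integral>x. (F (y - x) - E y)\<^sup>2 \<partial>W) = conv W p y - 2 * E y * E y + (E y)\<^sup>2"
          using W.integral_square_diff[of "\<lambda>x. F (y - x)" "E y"] elim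
          by (simp add: conv_def E_def)
        then show ?case by (simp add: power2_eq_square)
      qed
    qed simp_all
    finally have DG: "(\<integral>x. D x \<partial>W) = G" .
    have "(t / 2)\<^sup>2 * (1 - measure W S) = (\<integral>x. (t / 2)\<^sup>2 * (1 - indicator S x) \<partial>W)"
      using W.prob_space by (simp add: W.emeasure_eq_measure)
    also have "\<dots> \<le> (\<integral>x. D x \<partial>W)"
    proof (rule integral_mono[OF _ DI])
      show "(t / 2)\<^sup>2 * (1 - indicator S x) \<le> D x" for x
        by (auto simp: S_def indicator_def D_def Bochner_Integration.integral_nonneg not_less)
    qed (simp add: W.emeasure_eq_measure)
    finally have "(t / 2)\<^sup>2 * (1 - measure W S) \<le> G" by (simp add: DG)
    moreover have "(t / 2)\<^sup>2 * (1 / 2) \<le> (t / 2)\<^sup>2 * (1 - measure W S)"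
      using WS by (intro mult_left_mono) auto
    ultimately have G: "t\<^sup>2 / 8 \<le> G" by (simp add: power_divide)
    have "v / (16 * T\<^sup>2) = 2 * v / (8 * (2 * T)\<^sup>2)" by (simp add: power_mult_distrib)
    also have "\<dots> \<le> R\<^sup>2 / (8 * (real (k - 1))\<^sup>2)"
      using z k False by (intro frac_le mult_left_mono power_mono) (auto simp: R_def)
    also have "\<dots> = t\<^sup>2 / 8" by (simp add: t_def power_divide)
    finally show ?thesis using G by simp
  qed
  then show ?thesis by (simp add: v_def G_def E_def F_def[abs_def])
qed

end

end

subsection \<open>The contraction rate\<close>

text \<open>The inverse 3/8 bounds \<open>exp (- 1)\<close> in the Markov estimate, and
  \<open>8/5 * 8/3 \<ge> 4\<close> meets the condition on \<open>T\<close>. The quadratic Taylor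
  bound is taken at 1/4 and raised to the fourth power, because squaring it at 1/2 gives only about
  2.64.\<close>

lemma exp_1_ge: "8 / 3 \<le> exp (1 :: real)"
proof -
  have "1 + 1 / 4 + (1 / 4)\<^sup>2 / 2 \<le> exp (1 / 4 :: real)"
    by (rule exp_lower_Taylor_quadratic) simp
  then have "(1 + 1 / 4 + (1 / 4)\<^sup>2 / 2) ^ 4 \<le> exp (1 / 4 :: real) ^ 4"
    by (rule power_mono) simp
  moreover have "exp (1 / 4 :: real) ^ 4 = exp 1"
    by (simp add: exp_of_nat_mult[symmetric])
  ultimately show ?thesis by (simp add: power2_eq_square power4_eq_xxxx)
qed

lemma xlnx_convex:
  fixes a b :: real
  assumes "0 \<le> a" "0 \<le> b" "0 \<le> s" "0 \<le> t" "s + t = 1"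
  shows "(s * a + t * b) * ln (s * a + t * b) \<le> s * (a * ln a) + t * (b * ln b)"
proof -
  define c where "c = s * a + t * b"
  have "0 \<le> c" using assms by (simp add: c_def)
  show ?thesis
  proof (cases "c = 0")
    case True
    then have "s * a = 0" "t * b = 0"
      using assms unfolding c_def by (auto simp: add_nonneg_eq_0_iff)
    then show ?thesis by auto
  next
    case False
    with \<open>0 \<le> c\<close> have "0 < c" by simp
    have "s * (a * ln c + a - c) \<le> s * (a * ln a)" "t * (b * ln c + b - c) \<le> t * (b * ln b)"
      using assms \<open>0 < c\<close> by (auto intro!: mult_left_mono xlnx_ge_tangent)
    moreover have "s * (a * ln c + a - c) + t * (b * ln c + b - c) = c * ln c + c - (s + t) * c"
      by (simp add: c_def algebra_simps)
    ultimately show ?thesis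
      unfolding c_def[symmetric] using assms(5) by simp
  qed
qed

section \<open>Bounds and monotonicity for sinc and the rate\<close>

lemma nsinc_le_1: "0 < x \<Longrightarrow> nsinc x \<le> 1"
  using sin_x_le_x[of "pi * x"] by (simp add: nsinc_def)

lemma nsinc_nonneg: "0 < x \<Longrightarrow> x \<le> 1 \<Longrightarrow> 0 \<le> nsinc x"
  by (simp add: nsinc_def sin_ge_zero)

lemma nsinc_ge:
  assumes "0 < x"
  shows "1 - 8 / 3 * x\<^sup>2 \<le> nsinc x"
proof -
  define y where "y = pi * x"
  have y: "0 < y" using assms by (simp add: y_def)
  have "\<bar>sin y - (\<Sum>m<3. sin_coeff m * y ^ m)\<bar> \<le> inverse (fact 3) * \<bar>y\<bar> ^ 3"
    by (rule Maclaurin_sin_bound)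
  then have "\<bar>sin y - y\<bar> \<le> y ^ 3 / 6"
    using y by (simp add: eval_nat_numeral sin_coeff_def)
  then have "y - y ^ 3 / 6 \<le> sin y"
    using abs_le_D2 by fastforce
  then have "(y - y ^ 3 / 6) / y \<le> sin y / y"
    using y by (intro divide_right_mono) auto
  moreover have "(y - y ^ 3 / 6) / y = 1 - y\<^sup>2 / 6"
    using y by (simp add: field_simps power2_eq_square power3_eq_cube)
  \<comment> \<open>Replacing \<open>pi\<close> by 4 turns \<open>y\<^sup>2 / 6\<close> into
    \<open>16 / 6 * x\<^sup>2\<close>, the constant 8/3 of the claim.\<close>
  moreover have "y\<^sup>2 \<le> (4 * x)\<^sup>2"
    unfolding y_def using pi_less_4 assms by (intro power_mono mult_right_mono) auto
  ultimately show ?thesis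
    by (simp add: nsinc_def y_def power_mult_distrib)
qed

text \<open>With \<open>t = x / y\<close> the claim is \<open>t * sin b \<le> sin (t * b)\<close>,
  that is, concavity of \<open>sin\<close> on \<open>[0, pi]\<close> and \<open>sin 0 = 0\<close>.
  It follows from the derivative \<open>t * (cos (t * z) - cos z) \<ge> 0\<close>.\<close>

lemma nsinc_antimono:
  assumes "0 < x" "x \<le> y" "y \<le> 1"
  shows "nsinc y \<le> nsinc x"
proof -
  define t where "t = x / y"
  define b where "b = pi * y"
  have t: "0 < t" "t \<le> 1" and b: "0 < b" "b \<le> pi"
    using assms by (auto simp: t_def b_def)
  have "sin (t * 0) - t * sin 0 \<le> sin (t * b) - t * sin b"
  proof (rule DERIV_nonneg_imp_nondecreasing[where f = "\<lambda>z. sin (t * z) - t * sin z"])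
    fix z assume z: "0 \<le> z" "z \<le> b"
    have "t * z \<le> 1 * z" using t z by (intro mult_right_mono) auto
    then have "cos z \<le> cos (t * z)"
      using t z b by (intro cos_monotone_0_pi_le) auto
    then have "0 \<le> t * (cos (t * z) - cos z)" using t by simp
    moreover have "((\<lambda>z. sin (t * z) - t * sin z) has_real_derivative t * (cos (t * z) - cos z)) (at z)"
      by (auto intro!: derivative_eq_intros simp: algebra_simps)
    ultimately show "\<exists>d. ((\<lambda>z. sin (t * z) - t * sin z) has_real_derivative d) (at z) \<and> 0 \<le> d"
      by blast
  qed (use b in simp)
  then have "t * sin b \<le> sin (t * b)" by simp
  then have "t * sin b / (t * b) \<le> sin (t * b) / (t * b)"
    using t b by (intro divide_right_mono) auto
  then have "sin b / b \<le> sin (t * b) / (t * b)"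
    using t by simp
  moreover have tb: "t * b = pi * x" using assms by (simp add: t_def b_def)
  ultimately show ?thesis
    unfolding tb by (simp add: nsinc_def b_def)
qed

lemma rfun_ge: "3 / 4 \<le> rfun x"
proof -
  have "3 / 4 \<le> 1 - min (1 / 4) z" for z :: real by (simp add: min_def)
  then show ?thesis unfolding rfun_def .
qed

text \<open>As the argument grows, \<open>e\<close> grows and \<open>nsinc e\<close> shrinks, so the
  numerator of the fraction grows and its denominator shrinks. Arguments at most 0 keep
  \<open>e\<close> in the range where sinc decreases. This lets every factor of the product be
  replaced by the one at the least entropy.\<close>

lemma rfun_antimono:
  assumes "x \<le> y" "y \<le> 0"
  shows "rfun y \<le> rfun x"
proof -
  define e1 where "e1 = exp (6 * x - 2)"
  define e2 where "e2 = exp (6 * y - 2)"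
  define s1 where "s1 = (nsinc e1)\<^sup>2"
  define s2 where "s2 = (nsinc e2)\<^sup>2"
  have e: "0 < e1" "e1 \<le> e2" "e2 \<le> 1"
    using assms by (auto simp: e1_def e2_def)
  then have n: "0 \<le> nsinc e2" "nsinc e2 \<le> nsinc e1" "nsinc e1 \<le> 1"
    by (auto intro: nsinc_nonneg nsinc_antimono nsinc_le_1)
  then have s: "0 \<le> s2" "s2 \<le> s1" "s1 \<le> 1"
    unfolding s1_def s2_def by (auto intro: power_mono power_le_one)
  have "(1 - s1)\<^sup>2 / (8 + 16 * (s1 / e1)) \<le> (1 - s2)\<^sup>2 / (8 + 16 * (s2 / e2))"
  proof (rule frac_le)
    show "(1 - s1)\<^sup>2 \<le> (1 - s2)\<^sup>2" using s by (intro power_mono) auto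
    have "0 \<le> s2 / e2" using s e by simp
    then show "0 < 8 + 16 * (s2 / e2)" by linarith
    have "s2 / e2 \<le> s1 / e1" using s e by (intro frac_le) auto
    then show "8 + 16 * (s2 / e2) \<le> 8 + 16 * (s1 / e1)" by simp
  qed simp
  then show ?thesis
    unfolding rfun_def e1_def[symmetric] e2_def[symmetric] s1_def[symmetric] s2_def[symmetric]
    by (intro diff_left_mono min.mono order_refl)
qed

text \<open>Here \<open>u = exp (1 - 3 h)\<close> is the truncation level, so that \<open>exp (6 h - 2) = 1 / u\<^sup>2\<close>.\<close>

lemma rfun_lower_bound:
  assumes "h \<le> 0"
  shows "1 - 5 / 8 / (32 * (8 / 5 * exp (1 - 3 * h)) ^ 3 + 1) \<le> rfun h"
proof -
  define u where "u = exp (1 - 3 * h)"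
  define e where "e = exp (6 * h - 2)"
  define s where "s = nsinc e"
  have u: "8 / 3 \<le> u"
  proof -
    have "exp 1 \<le> u" using assms by (simp add: u_def)
    with exp_1_ge show ?thesis by linarith
  qed
  have eu: "e = 1 / u\<^sup>2"
    by (simp add: u_def e_def exp_minus[symmetric] exp_of_nat_mult[symmetric] divide_inverse algebra_simps)
  have e: "0 < e" by (simp add: e_def)
  have "(8 / 3)\<^sup>2 \<le> u\<^sup>2" using u by (intro power_mono) auto
  then have "e \<le> 1 / (8 / 3)\<^sup>2" unfolding eu using u by (intro divide_left_mono) auto
  then have e': "e \<le> 9 / 64" by (simp add: power2_eq_square)
  have "e\<^sup>2 \<le> (9 / 64)\<^sup>2" using e e' by (intro power_mono) auto
  then have e2: "e\<^sup>2 \<le> 81 / 4096" by (simp add: power2_eq_square)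
  have s: "1 - 8 / 3 * e\<^sup>2 \<le> s" "s \<le> 1" "0 \<le> s"
    unfolding s_def using nsinc_ge[OF e] nsinc_le_1[OF e] nsinc_nonneg[OF e] e' by simp_all
  have s34: "3 / 4 \<le> s" using s e2 by linarith
  have "(3 / 4)\<^sup>2 \<le> s\<^sup>2" using s34 by (intro power_mono) auto
  then have s2: "1 / 2 \<le> s\<^sup>2" by (simp add: power2_eq_square)
  have "1 - s\<^sup>2 = (1 - s) * (1 + s)" by (simp add: power2_eq_square algebra_simps)
  also have "\<dots> \<le> (8 / 3 * e\<^sup>2) * 2" using s by (intro mult_mono) auto
  finally have d: "1 - s\<^sup>2 \<le> 16 / 3 * e\<^sup>2" by simp
  have "s\<^sup>2 \<le> 1" using s by (simp add: power_le_one)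
  then have d2: "(1 - s\<^sup>2)\<^sup>2 \<le> (16 / 3 * e\<^sup>2)\<^sup>2"
    using d by (intro power_mono) auto
  have "1 / 2 / e \<le> s\<^sup>2 / e" using s2 e by (intro divide_right_mono) auto
  then have den: "8 / e \<le> 8 + 16 * (s\<^sup>2 / e)" by simp
  have "(1 - s\<^sup>2)\<^sup>2 / (8 + 16 * (s\<^sup>2 / e)) \<le> (16 / 3 * e\<^sup>2)\<^sup>2 / (8 / e)"
    using d2 den e by (intro frac_le) auto
  also have "\<dots> = 32 / 9 * e ^ 5"
    using e by (simp add: field_simps eval_nat_numeral)
  also have "\<dots> = 32 / 9 / u ^ 10"
    by (simp add: eu power_divide power_mult[symmetric])
  also have "\<dots> \<le> 5 / 8 / (32 * (8 / 5 * u) ^ 3 + 1)"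
  proof -
    \<comment> \<open>The powers 10 and 3 of \<open>u\<close> are compared: the excess
      \<open>u ^ 7 \<ge> (8 / 3) ^ 7 > 958\<close> absorbs all constants, and
      \<open>u ^ 3 \<ge> 18\<close> absorbs the summand \<open>+ 1\<close>.\<close>
    have "(8 / 3) ^ 7 \<le> u ^ 7" "(8 / 3) ^ 3 \<le> u ^ 3" using u by (auto intro!: power_mono)
    then have u7: "958 \<le> u ^ 7" and u3: "18 \<le> u ^ 3" by (auto simp: eval_nat_numeral)
    have "32 / 9 * (32 * (8 / 5 * u) ^ 3 + 1) \<le> 5 / 8 * 958 * u ^ 3"
      using u3 by (simp add: power_mult_distrib eval_nat_numeral)
    also have "\<dots> \<le> 5 / 8 * u ^ 7 * u ^ 3"
      using u7 u by (intro mult_right_mono mult_left_mono) auto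
    also have "\<dots> = 5 / 8 * u ^ 10" by (simp add: power_add[symmetric])
    finally have "32 / 9 * (32 * (8 / 5 * u) ^ 3 + 1) \<le> 5 / 8 * u ^ 10" .
    moreover have "0 < 32 * (8 / 5 * u) ^ 3 + 1" "0 < u ^ 10"
      using u by (auto intro!: add_pos_pos)
    ultimately show ?thesis
      by (simp only: divide_le_eq le_divide_eq pos_divide_le_eq pos_le_divide_eq) (simp add: field_simps)
  qed
  finally show ?thesis
    unfolding rfun_def e_def[symmetric] s_def[symmetric] u_def[symmetric] by linarith
qed

subsection \<open>Contraction of entropy\<close>

context haar_conv
begin

context
  fixes w :: "'g \<Rightarrow> real" and T :: real
  assumes W_eq: "W = density \<mu> (\<lambda>x. ennreal (w x))"
    and w_meas [measurable]: "w \<in> borel_measurable borel"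
    and w_nonneg: "\<And>x. 0 \<le> w x" and w_le: "\<And>x. w x \<le> T"
begin

lemma integral_W_le:
  fixes f :: "'g \<Rightarrow> real"
  assumes f: "integrable \<mu> f" and f0: "\<And>x. 0 \<le> f x"
  shows "(\<integral>x. f x \<partial>W) \<le> T * (\<integral>x. f x \<partial>\<mu>)"
proof -
  note [measurable] = borel_measurable_integrable_borel[OF f]
  have le: "w x * f x \<le> T * f x" for x
    using w_le f0 by (intro mult_right_mono)
  have "(\<integral>x. f x \<partial>W) = (\<integral>x. w x * f x \<partial>\<mu>)"
    unfolding W_eq by (subst integral_density) (simp_all add: w_nonneg)
  also have "\<dots> \<le> (\<integral>x. T * f x \<partial>\<mu>)"
  proof (rule integral_mono[OF _ _ le])
    show "integrable \<mu> (\<lambda>x. w x * f x)"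
    proof (rule Bochner_Integration.integrable_bound)
      show "integrable \<mu> (\<lambda>x. T * f x)" using f by simp
      have "norm (w x * f x) \<le> norm (T * f x)" for x
        using le[of x] f0[of x] w_nonneg[of x] by simp
      then show "AE x in \<mu>. norm (w x * f x) \<le> norm (T * f x)" by simp
    qed simp
  qed (use f in simp)
  finally show ?thesis by simp
qed

lemma measure_W_le:
  assumes [measurable]: "A \<in> sets borel"
  shows "measure W A \<le> T * measure \<mu> A"
proof -
  have "(\<integral>x. indicat_real A x \<partial>W) \<le> T * (\<integral>x. indicat_real A x \<partial>\<mu>)"
    by (rule integral_W_le) (simp_all add: emeasure_eq_measure)
  then show ?thesis by simp
qed

lemma conv_le:
  assumes f: "integrable \<mu> f" and f0: "\<And>x. 0 \<le> f x"
  shows "conv W f y \<le> T * (\<integral>x. f x \<partial>\<mu>)"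
proof -
  note fm [measurable] = borel_measurable_integrable_borel[OF f]
  have "conv W f y \<le> T * (\<integral>x. f (y - x) \<partial>\<mu>)"
    unfolding conv_def using integrable_reflect_iff[OF fm] f f0 by (intro integral_W_le) auto
  then show ?thesis by (simp add: integral_reflect)
qed

text \<open>The entropy is at most the chi-square divergence, which is estimated after expanding
  \<open>p = (F - m + m)\<^sup>2\<close> with \<open>F = sqrt p\<close> and \<open>m = \<integral> F\<close>.\<close>

lemma entropy_conv_le_variance:
  assumes p: "integrable \<mu> p" and p0: "\<And>y. 0 \<le> p y" and p1: "(\<integral>y. p y \<partial>\<mu>) = 1"
    and l: "integrable \<mu> (\<lambda>y. p y * ln (p y))" and T: "4 \<le> T"
  shows "(\<integral>y. conv W p y * ln (conv W p y) \<partial>\<mu>) \<le> 2 * T * (1 - (\<integral>y. sqrt (p y) \<partial>\<mu>)\<^sup>2)"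
proof -
  note [measurable] = borel_measurable_integrable_borel[OF p]
  define F where "F y = sqrt (p y)" for y
  have [measurable]: "F \<in> borel_measurable borel" by (simp add: F_def[abs_def])
  have F2 [simp]: "(F y)\<^sup>2 = p y" for y by (simp add: F_def p0)
  define m where "m = (\<integral>y. F y \<partial>\<mu>)"
  define v where "v = 1 - m\<^sup>2"
  have F: "integrable \<mu> F"
    unfolding F_def by (rule integrable_sqrt_density[OF p p0])
  have "m\<^sup>2 \<le> 1"
    using integral_square_le[OF F] p p1 by (simp add: m_def)
  then have v: "0 \<le> v" "v \<le> 1" by (auto simp: v_def)
  define E where "E = conv W F"
  define q where "q = conv W p"
  \<comment> \<open>Almost everywhere \<open>b\<close> equals
    \<open>conv W (\<lambda>y. (F y - m)\<^sup>2)\<close>. Hence it has integral \<open>v\<close>,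
    is at most \<open>T * v\<close> because \<open>W\<close> has density at most \<open>T\<close>,
    and dominates \<open>(E y - m)\<^sup>2\<close> by Jensen.\<close>
  define b where "b y = q y - 2 * m * E y + m\<^sup>2" for y
  have q: "integrable \<mu> q" and E: "integrable \<mu> E"
    unfolding q_def E_def by (intro integrable_conv p F)+
  have b: "integrable \<mu> b" unfolding b_def using q E by simp
  have qI: "(\<integral>y. q y \<partial>\<mu>) = 1" unfolding q_def using integral_conv[OF p] p1 by simp
  have EI: "(\<integral>y. E y \<partial>\<mu>) = m" unfolding E_def m_def using integral_conv[OF F] by simp
  have bI: "(\<integral>y. b y \<partial>\<mu>) = v"
    unfolding b_def v_def using q E by (simp add: qI EI power2_eq_square)
  have FmI: "integrable \<mu> (\<lambda>y. (F y - m)\<^sup>2)"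
    using p by (intro integrable_square_diff) simp_all
  have Fm: "(\<integral>y. (F y - m)\<^sup>2 \<partial>\<mu>) = v"
  proof -
    have "(\<integral>y. (F y - m)\<^sup>2 \<partial>\<mu>) = 1 - 2 * m * m + m\<^sup>2"
      using integral_square_diff[OF F, of m] p p1 by (simp add: m_def[symmetric])
    then show ?thesis by (simp add: v_def power2_eq_square[of m])
  qed
  have bT: "AE y in \<mu>. b y \<le> T * v"
    using AE_integrable_conv[OF p]
  proof eventually_elim
    case (elim y)
    have "integrable W (\<lambda>x. F (y - x))"
      unfolding F_def using W.finite_measure_axioms elim by (rule integrable_sqrt) (rule p0)
    then have "conv W (\<lambda>y. (F y - m)\<^sup>2) y = b y"
      using W.integral_square_diff[of "\<lambda>x. F (y - x)" m] elim
      by (simp add: conv_def b_def q_def E_def)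
    moreover have "conv W (\<lambda>y. (F y - m)\<^sup>2) y \<le> T * v"
      using conv_le[OF FmI] Fm by simp
    ultimately show ?case by simp
  qed
  have ab: "AE y in \<mu>. (E y - m)\<^sup>2 \<le> b y"
    using conv_sqrt_square_le[OF p p0]
  proof eventually_elim
    case (elim y)
    then have "(E y)\<^sup>2 \<le> q y" by (simp add: E_def q_def F_def[abs_def])
    then show ?case by (simp add: b_def power2_eq_square algebra_simps)
  qed
  have q0: "0 \<le> q y" for y unfolding q_def by (rule conv_nonneg[OF p0])
  have "(\<integral>y. q y * ln (q y) \<partial>\<mu>) \<le>
      (\<integral>y. (8 * m\<^sup>2 + 2 * T * v - 4 * v) * b y + (2 * v\<^sup>2 + q y - 1) \<partial>\<mu>)"
  proof (rule integral_mono_AE)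
    show "integrable \<mu> (\<lambda>y. q y * ln (q y))" unfolding q_def by (rule entropy_conv(1)[OF p p0 l])
    show "integrable \<mu> (\<lambda>y. (8 * m\<^sup>2 + 2 * T * v - 4 * v) * b y + (2 * v\<^sup>2 + q y - 1))"
      using b q by simp
    show "AE y in \<mu>. q y * ln (q y) \<le> (8 * m\<^sup>2 + 2 * T * v - 4 * v) * b y + (2 * v\<^sup>2 + q y - 1)"
      using bT ab
    proof eventually_elim
      case (elim y)
      have sq: "(s + t)\<^sup>2 \<le> 2 * s\<^sup>2 + 2 * t\<^sup>2" for s t :: real
        using zero_le_power2[of "s - t"] by (simp add: power2_sum power2_diff)
      define a where "a = E y - m"
      have "q y * ln (q y) \<le> q y * (q y - 1)"
      proof (cases "q y = 0")
        case False
        with q0[of y] show ?thesis by (intro mult_left_mono ln_le_minus_one) auto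
      qed simp
      also have "\<dots> = (q y - 1)\<^sup>2 + (q y - 1)" by (simp add: power2_eq_square algebra_simps)
      \<comment> \<open>The deviation of \<open>q\<close> splits into a part linear in
        \<open>a\<close> and a part quadratic in \<open>F - m\<close>. Both squares are then at most
        multiples of \<open>b y\<close>, up to terms that integrate explicitly.\<close>
      also have "q y - 1 = 2 * m * a + (b y - v)"
        by (simp add: a_def b_def v_def power2_eq_square algebra_simps)
      also have "(2 * m * a + (b y - v))\<^sup>2 \<le> 2 * (2 * m * a)\<^sup>2 + 2 * (b y - v)\<^sup>2"
        by (rule sq)
      also have "2 * (2 * m * a)\<^sup>2 = 8 * m\<^sup>2 * a\<^sup>2" by (simp add: power_mult_distrib)
      also have "8 * m\<^sup>2 * a\<^sup>2 \<le> 8 * m\<^sup>2 * b y"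
        using elim(2) by (intro mult_left_mono) (auto simp: a_def)
      also have "2 * (b y - v)\<^sup>2 = 2 * (b y * b y) - 4 * v * b y + 2 * v\<^sup>2"
        by (simp add: power2_eq_square algebra_simps)
      also have "b y * b y \<le> T * v * b y"
        using elim zero_le_power2[of "E y - m"] by (intro mult_right_mono) linarith+
      finally have "q y * ln (q y) \<le>
        8 * m\<^sup>2 * b y + (2 * (T * v * b y) - 4 * v * b y + 2 * v\<^sup>2) + (2 * m * a + (b y - v))"
        by simp
      moreover have "2 * m * a + (b y - v) = q y - 1"
        by (simp add: a_def b_def v_def power2_eq_square algebra_simps)
      ultimately show ?case by (simp add: algebra_simps)
    qed
  qed
  also have "\<dots> = (8 * m\<^sup>2 + 2 * T * v - 4 * v) * v + 2 * v\<^sup>2"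
    using b q by (simp add: bI qI)
  also have "\<dots> = 2 * T * v - v * ((2 * T - 8) * (1 - v) + 2 * v)"
    by (simp add: v_def power2_eq_square algebra_simps)
  also have "\<dots> \<le> 2 * T * v"
    using v T by (simp add: mult_nonneg_nonneg add_nonneg_nonneg)
  finally show ?thesis
    by (simp add: q_def v_def m_def F_def[abs_def])
qed

lemma entropy_contraction_bounded_density:
  assumes conn: "connected (UNIV :: 'g set)"
    and p: "integrable \<mu> p" and p0: "\<And>y. 0 \<le> p y" and p1: "(\<integral>y. p y \<partial>\<mu>) = 1"
    and l: "integrable \<mu> (\<lambda>y. p y * ln (p y))" and T: "4 \<le> T"
  shows "(1 + 1 / (32 * T ^ 3)) * (\<integral>y. conv W p y * ln (conv W p y) \<partial>\<mu>) \<le> (\<integral>y. p y * ln (p y) \<partial>\<mu>)"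
proof -
  define H where "H = (\<integral>y. conv W p y * ln (conv W p y) \<partial>\<mu>)"
  define v where "v = 1 - (\<integral>y. sqrt (p y) \<partial>\<mu>)\<^sup>2"
  have "H \<le> 2 * T * v"
    unfolding H_def v_def by (rule entropy_conv_le_variance[OF p p0 p1 l T])
  \<comment> \<open>The weight is \<open>2 * T\<close> times \<open>16 * T\<^sup>2\<close>, which
    matches the upper bound in terms of \<open>v\<close> with the lower bound of
    \<open>variance_gap\<close>.\<close>
  then have "H / (32 * T ^ 3) \<le> 2 * T * v / (32 * T ^ 3)"
    using T by (intro divide_right_mono) auto
  also have "\<dots> = v / (16 * T\<^sup>2)"
    using T by (simp add: field_simps eval_nat_numeral)
  also have "\<dots> \<le> (\<integral>y. conv W p y - (conv W (\<lambda>y. sqrt (p y)) y)\<^sup>2 \<partial>\<mu>)"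
    unfolding v_def using T by (intro variance_gap[OF p p0 conn p1] measure_W_le) auto
  finally have "H + H / (32 * T ^ 3) \<le> (\<integral>y. p y * ln (p y) \<partial>\<mu>)"
    using entropy_conv(2)[OF p p0 l] by (simp add: H_def)
  then show ?thesis by (simp add: H_def[symmetric] algebra_simps)
qed

end

end

context haar_group
begin

lemma haar_conv_density:
  assumes w: "integrable \<mu> w" and w0: "\<And>x. 0 \<le> w x" and w1: "(\<integral>x. w x \<partial>\<mu>) = 1"
  shows "haar_conv \<mu> (density \<mu> (\<lambda>x. ennreal (w x)))"
proof -
  note [measurable] = borel_measurable_integrable_borel[OF w]
  have "(\<integral>\<^sup>+x. ennreal (w x) \<partial>\<mu>) = 1"
    using nn_integral_eq_integral[OF w] w0 w1 by simp
  then have "prob_space (density \<mu> (\<lambda>x. ennreal (w x)))"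
    by (intro prob_spaceI) (simp add: emeasure_density)
  then show ?thesis
    by (intro haar_conv.intro haar_conv_axioms.intro haar_group_axioms) simp_all
qed

text \<open>Finite entropy of \<open>W\<close> limits the mass where \<open>w\<close> exceeds
  \<open>u\<close>, so a fixed share 5/8 of \<open>W\<close> has a bounded density and contracts.
  The remaining share 3/8 at least does not increase the integral of \<open>p ln p\<close>, and
  convexity of \<open>t * ln t\<close> combines the two.\<close>

lemma entropy_contraction:
  assumes conn: "connected (UNIV :: 'g set)"
    and p: "integrable \<mu> p" and p0: "\<And>y. 0 \<le> p y" and p1: "(\<integral>y. p y \<partial>\<mu>) = 1"
    and pl: "integrable \<mu> (\<lambda>y. p y * ln (p y))"
    and w: "integrable \<mu> w" and w0: "\<And>y. 0 \<le> w y" and w1: "(\<integral>y. w y \<partial>\<mu>) = 1"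
    and wl: "integrable \<mu> (\<lambda>y. w y * ln (w y))"
  defines "W \<equiv> density \<mu> (\<lambda>x. ennreal (w x))"
    and "h \<equiv> - (\<integral>y. w y * ln (w y) \<partial>\<mu>)"
  shows "(\<integral>y. conv W p y * ln (conv W p y) \<partial>\<mu>) \<le> rfun h * (\<integral>y. p y * ln (p y) \<partial>\<mu>)"
proof -
  note [measurable] = borel_measurable_integrable_borel[OF w] borel_measurable_integrable_borel[OF p]
  define Hp where "Hp = (\<integral>y. p y * ln (p y) \<partial>\<mu>)"
  have nonneg: "0 \<le> (\<integral>y. f y * ln (f y) \<partial>\<mu>)"
    if "integrable \<mu> f" "\<And>y. 0 \<le> f y" "(\<integral>y. f y \<partial>\<mu>) = 1" "integrable \<mu> (\<lambda>y. f y * ln (f y))" for f :: "'g \<Rightarrow> real"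
  proof -
    have "(\<integral>y. f y - 1 \<partial>\<mu>) \<le> (\<integral>y. f y * ln (f y) \<partial>\<mu>)"
      by (rule integral_mono) (use that xlnx_ge in auto)
    with that show ?thesis by simp
  qed
  have h: "h \<le> 0" using nonneg[OF w w0 w1 wl] by (simp add: h_def)
  have Hp: "0 \<le> Hp" unfolding Hp_def by (rule nonneg[OF p p0 p1 pl])
  define u where "u = exp (1 - 3 * h)"
  have u: "8 / 3 \<le> u" "0 < u"
  proof -
    have "exp 1 \<le> u" using h by (simp add: u_def)
    with exp_1_ge show "8 / 3 \<le> u" by linarith
    then show "0 < u" by linarith
  qed
  define A where "A = {x. w x \<le> u}"
  have [measurable]: "A \<in> sets borel" by (simp add: A_def)
  have wA: "integrable \<mu> (\<lambda>x. w x * indicator A x)"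
    using w by (intro integrable_real_mult_indicator) simp_all
  define c where "c = (\<integral>x. w x * indicator A x \<partial>\<mu>)"
  have c: "5 / 8 \<le> c"
  proof -
    \<comment> \<open>Markov's inequality for \<open>ln w\<close>: off \<open>A\<close> one has
      \<open>ln (w x) > ln u = 1 - 3 * h\<close>; on \<open>A\<close> the left side vanishes and
      \<open>t * ln t \<ge> - exp (- 1) \<ge> - 3/8\<close>.\<close>
    have "(1 - 3 * h) * (w x - w x * indicator A x) \<le> w x * ln (w x) + 3 / 8" for x
    proof (cases "x \<in> A")
      case True
      have "w x * ln (exp (- 1)) + w x - exp (- 1) \<le> w x * ln (w x)"
        by (rule xlnx_ge_tangent) (simp_all add: w0)
      moreover have "exp (- 1 :: real) \<le> 3 / 8"
      proof -
        have "inverse (exp 1) \<le> inverse (8 / 3 :: real)"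
          by (rule le_imp_inverse_le[OF exp_1_ge]) simp
        then show ?thesis by (simp add: exp_minus)
      qed
      ultimately show ?thesis using True by simp
    next
      case False
      then have "u < w x" by (simp add: A_def)
      then have "ln u \<le> ln (w x)" using u by simp
      then have "w x * (1 - 3 * h) \<le> w x * ln (w x)"
        using w0 by (intro mult_left_mono) (auto simp: u_def)
      with False show ?thesis by (simp add: mult.commute)
    qed
    then have "(\<integral>x. (1 - 3 * h) * (w x - w x * indicator A x) \<partial>\<mu>) \<le> (\<integral>x. w x * ln (w x) + 3 / 8 \<partial>\<mu>)"
      using w wA wl by (intro integral_mono) auto
    then have "(1 - 3 * h) * (1 - c) \<le> - h + 3 / 8"
      using w wA wl by (simp add: c_def w1 h_def)
    \<comment> \<open>The slope 3 in the level \<open>u\<close> is large enough because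
      \<open>3 * 3/8 \<ge> 1\<close> and \<open>h \<le> 0\<close>.\<close>
    also have "\<dots> \<le> (1 - 3 * h) * (3 / 8)" using h by simp
    finally have "1 - c \<le> 3 / 8"
      by (rule mult_left_le_imp_le) (use h in simp)
    then show ?thesis by simp
  qed
  \<comment> \<open>\<open>w1'\<close> is \<open>w\<close> conditioned on \<open>A\<close>, and
    \<open>w = 5/8 * w1' + 3/8 * w2'\<close>. The weight is 5/8 rather than \<open>c\<close> because
    \<open>1 - c\<close> may vanish; \<open>c \<ge> 5/8\<close> keeps \<open>w2'\<close>
    nonnegative.\<close>
  define w1' where "w1' x = w x * indicator A x / c" for x
  define w2' where "w2' x = 8 / 3 * (w x - 5 / 8 * w1' x)" for x
  define T where "T = 8 / 5 * u"
  have T: "4 \<le> T" using u by (simp add: T_def)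
  have i1: "integrable \<mu> w1'" and i2: "integrable \<mu> w2'"
    unfolding w1'_def w2'_def using w wA by simp_all
  have n1: "0 \<le> w1' x" "w1' x \<le> T" for x
  proof -
    show "0 \<le> w1' x" using c w0 by (simp add: w1'_def)
    have "w1' x \<le> u / (5 / 8)"
      unfolding w1'_def using c u w0 by (intro frac_le) (auto simp: indicator_def A_def)
    then show "w1' x \<le> T" by (simp add: T_def)
  qed
  have n2: "0 \<le> w2' x" for x
  proof -
    have "w1' x \<le> w x / (5 / 8)"
      unfolding w1'_def using c w0 by (intro frac_le) (auto simp: indicator_def)
    then show ?thesis by (simp add: w2'_def)
  qed
  have I1: "(\<integral>x. w1' x \<partial>\<mu>) = 1"
    unfolding w1'_def using wA c by (simp add: c_def[symmetric])
  have I2: "(\<integral>x. w2' x \<partial>\<mu>) = 1"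
    unfolding w2'_def using i1 w by (simp add: I1 w1)
  define W1 where "W1 = density \<mu> (\<lambda>x. ennreal (w1' x))"
  define W2 where "W2 = density \<mu> (\<lambda>x. ennreal (w2' x))"
  interpret W: haar_conv \<mu> W unfolding W_def by (rule haar_conv_density[OF w w0 w1])
  interpret W1: haar_conv \<mu> W1 unfolding W1_def by (rule haar_conv_density[OF i1 n1(1) I1])
  interpret W2: haar_conv \<mu> W2 unfolding W2_def by (rule haar_conv_density[OF i2 n2 I2])
  note [measurable] = borel_measurable_integrable_borel[OF i1] borel_measurable_integrable_borel[OF i2]
  define H where "H = (\<integral>y. conv W p y * ln (conv W p y) \<partial>\<mu>)"
  define H1 where "H1 = (\<integral>y. conv W1 p y * ln (conv W1 p y) \<partial>\<mu>)"
  define H2 where "H2 = (\<integral>y. conv W2 p y * ln (conv W2 p y) \<partial>\<mu>)"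
  have mix: "AE y in \<mu>. conv W p y = 5 / 8 * conv W1 p y + 3 / 8 * conv W2 p y"
    using W1.AE_integrable_conv[OF p] W2.AE_integrable_conv[OF p]
  proof eventually_elim
    case (elim y)
    have j: "integrable \<mu> (\<lambda>x. w1' x * p (y - x))" "integrable \<mu> (\<lambda>x. w2' x * p (y - x))"
      using elim by (simp_all add: W1_def W2_def integrable_density n1 n2)
    have "conv W p y = (\<integral>x. w x * p (y - x) \<partial>\<mu>)"
      unfolding conv_def W_def by (subst integral_density) (simp_all add: w0)
    also have "\<dots> = (\<integral>x. 5 / 8 * (w1' x * p (y - x)) + 3 / 8 * (w2' x * p (y - x)) \<partial>\<mu>)"
      by (intro Bochner_Integration.integral_cong) (auto simp: w2'_def algebra_simps)
    also have "\<dots> = 5 / 8 * (\<integral>x. w1' x * p (y - x) \<partial>\<mu>) + 3 / 8 * (\<integral>x. w2' x * p (y - x) \<partial>\<mu>)"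
      using j by simp
    also have "(\<integral>x. w1' x * p (y - x) \<partial>\<mu>) = conv W1 p y"
      unfolding conv_def W1_def by (subst integral_density) (simp_all add: n1)
    also have "(\<integral>x. w2' x * p (y - x) \<partial>\<mu>) = conv W2 p y"
      unfolding conv_def W2_def by (subst integral_density) (simp_all add: n2)
    finally show ?case .
  qed
  note e1 = W1.entropy_conv(1)[OF p p0 pl] and e2 = W2.entropy_conv(1)[OF p p0 pl]
  have "H \<le> (\<integral>y. 5 / 8 * (conv W1 p y * ln (conv W1 p y)) + 3 / 8 * (conv W2 p y * ln (conv W2 p y)) \<partial>\<mu>)"
    unfolding H_def
  proof (rule integral_mono_AE)
    show "AE y in \<mu>. conv W p y * ln (conv W p y) \<le>
        5 / 8 * (conv W1 p y * ln (conv W1 p y)) + 3 / 8 * (conv W2 p y * ln (conv W2 p y))"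
      using mix
    proof eventually_elim
      case (elim y)
      show ?case
        unfolding elim by (rule xlnx_convex) (auto intro!: W1.conv_nonneg W2.conv_nonneg p0)
    qed
  qed (use W.entropy_conv(1)[OF p p0 pl] e1 e2 in simp_all)
  also have "\<dots> = 5 / 8 * H1 + 3 / 8 * H2"
    using e1 e2 by (simp add: H1_def H2_def)
  finally have HH: "H \<le> 5 / 8 * H1 + 3 / 8 * H2" .
  have H2: "H2 \<le> Hp"
  proof -
    have "0 \<le> (\<integral>y. conv W2 p y - (conv W2 (\<lambda>y. sqrt (p y)) y)\<^sup>2 \<partial>\<mu>)"
      using W2.conv_sqrt_square_le[OF p p0] by (intro integral_nonneg_AE) simp
    with W2.entropy_conv(2)[OF p p0 pl] show ?thesis by (simp add: H2_def Hp_def)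
  qed
  define x where "x = 32 * T ^ 3"
  have x: "0 < x" using T by (simp add: x_def)
  have "(1 + 1 / x) * H1 \<le> Hp"
    unfolding H1_def Hp_def x_def
    by (rule W1.entropy_contraction_bounded_density[OF W1_def _ n1(1) n1(2) conn p p0 p1 pl T]) simp
  then have "H1 + H1 / x \<le> Hp" by (simp add: algebra_simps)
  then have "x * (H1 + H1 / x) \<le> x * Hp" using x by (intro mult_left_mono) auto
  then have "H1 * (x + 1) \<le> x * Hp" using x by (simp add: algebra_simps)
  then have "H1 \<le> x * Hp / (x + 1)" using x by (simp add: pos_le_divide_eq)
  also have "\<dots> = Hp - Hp / (x + 1)" using x by (simp add: field_simps)
  finally have "H1 \<le> Hp - Hp / (x + 1)" .
  then have "5 / 8 * H1 \<le> 5 / 8 * (Hp - Hp / (x + 1))" by (rule mult_left_mono) simp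
  moreover have "3 / 8 * H2 \<le> 3 / 8 * Hp" using H2 by simp
  ultimately have "H \<le> 5 / 8 * (Hp - Hp / (x + 1)) + 3 / 8 * Hp"
    using HH by (meson add_mono order_trans)
  \<comment> \<open>Only the share 5/8 gains the factor \<open>1 - 1 / (x + 1)\<close>; the total is
    the expression estimated in \<open>rfun_lower_bound\<close>.\<close>
  also have "\<dots> = (1 - 5 / 8 / (x + 1)) * Hp" using x by (simp add: field_simps)
  also have "\<dots> \<le> rfun h * Hp"
    using rfun_lower_bound[OF h] Hp by (intro mult_right_mono) (auto simp: x_def T_def u_def)
  finally show ?thesis by (simp add: H_def Hp_def)
qed

end

subsection \<open>Sums of independent random variables\<close>

lemma ext_integral_eq_integral:
  assumes "integrable M f"
  shows "ext_integral M f = ereal (\<integral>x. f x \<partial>M)"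
proof -
  have A: "(\<integral>\<^sup>+x. ennreal (f x) \<partial>M) \<noteq> \<infinity>" and B: "(\<integral>\<^sup>+x. ennreal (- f x) \<partial>M) \<noteq> \<infinity>"
    using assms by (auto simp: real_integrable_def)
  have fin: "enn2ereal z = ereal (enn2real z)" if "z \<noteq> \<infinity>" for z
    using that by (cases z) auto
  show ?thesis
    unfolding ext_integral_def fin[OF A] fin[OF B] real_lebesgue_integral_def[OF assms] by simp
qed

context haar_group
begin

lemma distr_haar: "distr M \<mu> X = distr M borel X"
  by (rule distr_cong) simp_all

lemma haar_entropy_density:
  assumes "X \<in> borel_measurable M" "distr M borel X = density \<mu> (\<lambda>x. ennreal (f x))"
    and f: "integrable \<mu> f" and f0: "\<And>x. 0 \<le> f x" and l: "integrable \<mu> (\<lambda>x. f x * ln (f x))"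
  shows "haar_entropy \<mu> M X = ereal (- (\<integral>x. f x * ln (f x) \<partial>\<mu>))"
proof -
  have "distributed M \<mu> X (\<lambda>x. ennreal (f x))"
    unfolding distributed_def distr_haar using assms f by (simp add: measurable_haar_iff)
  from haar_entropy_eq[OF prob_space_axioms this f0] show ?thesis
    by (simp add: ext_integral_eq_integral[OF l])
qed

text \<open>This passes from extended to real integrals. Since \<open>- t * ln t \<le> 1\<close> for
  \<open>t \<ge> 0\<close>, the negative part of \<open>f ln f\<close> always has finite integral;
  an infinite positive part would make the entropy \<open>- \<infinity>\<close>.\<close>

lemma haar_entropy_finite_density:
  assumes M: "prob_space M" and X: "X \<in> borel_measurable M" and h: "haar_entropy \<mu> M X > - \<infinity>"
  obtains f where "integrable \<mu> f" "\<And>x. 0 \<le> f x" "(\<integral>x. f x \<partial>\<mu>) = 1" "integrable \<mu> (\<lambda>x. f x * ln (f x))"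
    "distr M borel X = density \<mu> (\<lambda>x. ennreal (f x))" "haar_entropy \<mu> M X = ereal (- (\<integral>x. f x * ln (f x) \<partial>\<mu>))"
proof -
  interpret M: prob_space M by fact
  have "\<exists>g. distributed M \<mu> X g"
  proof (rule ccontr)
    assume "\<nexists>g. distributed M \<mu> X g"
    then have "haar_entropy \<mu> M X = - \<infinity>" unfolding haar_entropy_def by (rule if_not_P)
    with h show False by simp
  qed
  then obtain g where g: "distributed M \<mu> X g" ..
  then have gm [measurable]: "g \<in> borel_measurable \<mu>" and gd: "distr M \<mu> X = density \<mu> g"
    by (auto simp: distributed_def)
  have gI: "(\<integral>\<^sup>+x. g x \<partial>\<mu>) = 1"
  proof -
    have "emeasure (density \<mu> g) UNIV = emeasure (distr M \<mu> X) UNIV" by (simp add: gd)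
    also have "\<dots> = 1"
      using X M.emeasure_space_1 by (subst emeasure_distr) (auto simp: measurable_haar_iff)
    finally show ?thesis by (simp add: emeasure_density)
  qed
  define f where "f x = enn2real (g x)" for x
  have f0: "0 \<le> f x" for x by (simp add: f_def)
  have [measurable]: "f \<in> borel_measurable \<mu>" by (simp add: f_def[abs_def])
  have "AE x in \<mu>. g x \<noteq> \<infinity>"
    by (rule nn_integral_noteq_infinite) (simp_all add: gI)
  then have gf: "AE x in \<mu>. g x = ennreal (f x)"
    by eventually_elim (simp add: f_def less_top)
  have D: "distr M borel X = density \<mu> (\<lambda>x. ennreal (f x))"
  proof -
    have "density \<mu> g = density \<mu> (\<lambda>x. ennreal (f x))"
      by (rule density_cong[OF _ _ gf]) simp_all
    with gd show ?thesis by (simp add: distr_haar)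
  qed
  have fI: "(\<integral>\<^sup>+x. ennreal (f x) \<partial>\<mu>) = 1"
    using gI nn_integral_cong_AE[OF gf] by simp
  have f: "integrable \<mu> f"
    by (rule integrableI_nonneg) (simp_all add: f0 fI)
  have f1: "(\<integral>x. f x \<partial>\<mu>) = 1"
    using nn_integral_eq_integral[OF f] f0 fI by (simp add: ennreal_eq_1)
  have ext: "haar_entropy \<mu> M X = - ext_integral \<mu> (\<lambda>x. f x * ln (f x))"
    using D X f by (intro haar_entropy_eq[OF prob_space_axioms _ f0])
      (simp add: distributed_def distr_haar measurable_haar_iff)
  have neg: "(\<integral>\<^sup>+x. ennreal (- (f x * ln (f x))) \<partial>\<mu>) \<le> 1"
  proof -
    have "- (f x * ln (f x)) \<le> 1" for x
      using xlnx_ge[OF f0[of x]] f0[of x] by linarith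
    then have "(\<integral>\<^sup>+x. ennreal (- (f x * ln (f x))) \<partial>\<mu>) \<le> (\<integral>\<^sup>+x. 1 \<partial>\<mu>)"
      by (intro nn_integral_mono) simp
    then show ?thesis by simp
  qed
  have neg_fin: "(\<integral>\<^sup>+x. ennreal (- (f x * ln (f x))) \<partial>\<mu>) \<noteq> \<infinity>"
    using le_less_trans[OF neg ennreal_one_less_top] by auto
  have fin: "(\<integral>\<^sup>+x. ennreal (f x * ln (f x)) \<partial>\<mu>) \<noteq> \<infinity>"
  proof
    assume inf: "(\<integral>\<^sup>+x. ennreal (f x * ln (f x)) \<partial>\<mu>) = \<infinity>"
    from neg_fin obtain r where "(\<integral>\<^sup>+x. ennreal (- (f x * ln (f x))) \<partial>\<mu>) = ennreal r" "0 \<le> r"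
      by (metis ennreal_cases infinity_ennreal_def)
    then have "ext_integral \<mu> (\<lambda>x. f x * ln (f x)) = \<infinity>"
      by (simp add: ext_integral_def inf)
    with ext h show False by simp
  qed
  have l: "integrable \<mu> (\<lambda>x. f x * ln (f x))"
    using fin neg_fin by (simp add: real_integrable_def)
  show ?thesis
    by (rule that[OF f f0 f1 l D haar_entropy_density[OF X D f f0 l]])
qed

section \<open>Laws and entropies of independent sums\<close>

lemma distr_sum_indep:
  assumes M: "prob_space M" and ind: "prob_space.indep_var M borel X borel Y"
    and X: "distr M borel X = density \<mu> (\<lambda>x. ennreal (p x))" and p: "integrable \<mu> p" "\<And>x. 0 \<le> p x"
    and Y: "distr M borel Y = W"
  shows "distr M borel (\<lambda>\<omega>. X \<omega> + Y \<omega>) = density \<mu> (\<lambda>x. ennreal (conv W p x))"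
proof -
  interpret M: prob_space M by fact
  have [measurable]: "X \<in> borel_measurable M" "Y \<in> borel_measurable M"
    and eq: "distr M borel X \<Otimes>\<^sub>M distr M borel Y = distr M (borel \<Otimes>\<^sub>M borel) (\<lambda>\<omega>. (X \<omega>, Y \<omega>))"
    using ind by (auto simp: M.indep_var_distribution_eq)
  interpret haar_conv \<mu> W
    unfolding Y[symmetric]
    by (intro haar_conv.intro haar_conv_axioms.intro haar_group_axioms M.prob_space_distr) simp_all
  have "distr M borel (\<lambda>\<omega>. X \<omega> + Y \<omega>) = distr (distr M (borel \<Otimes>\<^sub>M borel) (\<lambda>\<omega>. (X \<omega>, Y \<omega>))) borel (\<lambda>(x, y). x + y)"
    by (subst distr_distr) (simp_all add: comp_def)
  also have "\<dots> = distr (density \<mu> (\<lambda>x. ennreal (p x)) \<Otimes>\<^sub>M W) \<mu> (\<lambda>(x, y). x + y)"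
    unfolding eq[symmetric] X Y distr_haar ..
  also have "\<dots> = density \<mu> (\<lambda>x. ennreal (conv W p x))"
    by (rule density_conv[OF p])
  finally show ?thesis .
qed

lemma indep_var_sum:
  fixes X :: "'i \<Rightarrow> 'c \<Rightarrow> 'g"
  assumes M: "prob_space M" and ind: "prob_space.indep_vars M (\<lambda>_. borel) X K"
    and J: "J \<subseteq> K" "i \<in> K" "i \<notin> J"
  shows "prob_space.indep_var M borel (\<lambda>\<omega>. \<Sum>k\<in>J. X k \<omega>) borel (X i)"
proof -
  interpret M: prob_space M by fact
  have "M.indep_var borel ((\<lambda>f. \<Sum>k\<in>J. f k) \<circ> (\<lambda>\<omega>. restrict (\<lambda>k. X k \<omega>) J))
      borel ((\<lambda>f. f i) \<circ> (\<lambda>\<omega>. restrict (\<lambda>k. X k \<omega>) {i}))"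
    using J by (intro M.indep_var_compose[OF M.indep_var_restrict[OF ind, of J "{i}"]] measurable_group_sum) auto
  also have "(\<lambda>f. \<Sum>k\<in>J. f k) \<circ> (\<lambda>\<omega>. restrict (\<lambda>k. X k \<omega>) J) = (\<lambda>\<omega>. \<Sum>k\<in>J. X k \<omega>)"
    by (auto simp: fun_eq_iff)
  also have "(\<lambda>f. f i) \<circ> (\<lambda>\<omega>. restrict (\<lambda>k. X k \<omega>) {i}) = X i"
    by auto
  finally show ?thesis .
qed

text \<open>The witness \<open>conv W p\<close> has again all the properties required of
  \<open>p\<close>, so that summands can be added one at a time by induction.\<close>

lemma entropy_sum_indep_le:
  assumes conn: "connected (UNIV :: 'g set)" and M: "prob_space M"
    and ind: "prob_space.indep_var M borel X borel Y"
    and X: "distr M borel X = density \<mu> (\<lambda>x. ennreal (p x))"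
    and Y: "distr M borel Y = density \<mu> (\<lambda>x. ennreal (w x))"
    and p: "integrable \<mu> p" "\<And>x. 0 \<le> p x" "(\<integral>x. p x \<partial>\<mu>) = 1" "integrable \<mu> (\<lambda>x. p x * ln (p x))"
    and w: "integrable \<mu> w" "\<And>x. 0 \<le> w x" "(\<integral>x. w x \<partial>\<mu>) = 1" "integrable \<mu> (\<lambda>x. w x * ln (w x))"
  obtains q where "integrable \<mu> q" "\<And>x. 0 \<le> q x" "(\<integral>x. q x \<partial>\<mu>) = 1" "integrable \<mu> (\<lambda>x. q x * ln (q x))"
    "distr M borel (\<lambda>\<omega>. X \<omega> + Y \<omega>) = density \<mu> (\<lambda>x. ennreal (q x))"
    "(\<integral>x. q x * ln (q x) \<partial>\<mu>) \<le> rfun (- (\<integral>x. w x * ln (w x) \<partial>\<mu>)) * (\<integral>x. p x * ln (p x) \<partial>\<mu>)"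
proof -
  define W where "W = density \<mu> (\<lambda>x. ennreal (w x))"
  note W = haar_conv_density[OF w(1-3), folded W_def]
  show ?thesis
  proof (rule that)
    show "integrable \<mu> (conv W p)" using W p(1) by (rule haar_conv.integrable_conv)
    show "0 \<le> conv W p x" for x using W p(2) by (rule haar_conv.conv_nonneg)
    show "(\<integral>x. conv W p x \<partial>\<mu>) = 1" using haar_conv.integral_conv[OF W p(1)] p(3) by simp
    show "integrable \<mu> (\<lambda>x. conv W p x * ln (conv W p x))" using W p(1,2,4) by (rule haar_conv.entropy_conv)
    show "distr M borel (\<lambda>\<omega>. X \<omega> + Y \<omega>) = density \<mu> (\<lambda>x. ennreal (conv W p x))"
      by (rule distr_sum_indep[OF M ind X p(1,2) Y[folded W_def]])
    show "(\<integral>x. conv W p x * ln (conv W p x) \<partial>\<mu>) \<le>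
        rfun (- (\<integral>x. w x * ln (w x) \<partial>\<mu>)) * (\<integral>x. p x * ln (p x) \<partial>\<mu>)"
      unfolding W_def by (rule entropy_contraction[OF conn p w])
  qed
qed

text \<open>The sum is built up from \<open>X j\<close>, and each further \<open>X i\<close>
  multiplies the bound by its own rate. Maximal entropy of \<open>X j\<close> means that
  \<open>D j\<close> is the least relative entropy, and \<open>rfun_antimono\<close> bounds each
  rate by the one at the minimal entropy.\<close>

lemma rel_entropy_sum_le:
  fixes X :: "nat \<Rightarrow> 'b \<Rightarrow> 'g" and M :: "'b measure"
  assumes conn: "connected (UNIV :: 'g set)" and M: "prob_space M"
    and ind: "prob_space.indep_vars M (\<lambda>_. borel) X {1..n}"
    and fin: "\<And>i. i \<in> {1..n} \<Longrightarrow> haar_entropy \<mu> M (X i) > - \<infinity>"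
    and j: "j \<in> {1..n}"
    and max: "haar_entropy \<mu> M (X j) = (MAX i\<in>{1..n}. haar_entropy \<mu> M (X i))"
  shows "rel_entropy (distr M borel (\<lambda>\<omega>. \<Sum>i=1..n. X i \<omega>)) \<mu>
           \<le> ereal (\<Prod>i\<in>{1..n} - {j}. rfun (real_of_ereal (haar_entropy \<mu> M (X i))))
               * rel_entropy (distr M borel (X j)) \<mu>
       \<and> ereal (\<Prod>i\<in>{1..n} - {j}. rfun (real_of_ereal (haar_entropy \<mu> M (X i))))
               * rel_entropy (distr M borel (X j)) \<mu>
           \<le> ereal (rfun (real_of_ereal (MIN i\<in>{1..n}. haar_entropy \<mu> M (X i))) ^ (n - 1))
               * (MIN i\<in>{1..n}. rel_entropy (distr M borel (X i)) \<mu>)"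
proof -
  have X: "X i \<in> borel_measurable M" if "i \<in> {1..n}" for i
    using ind that by (auto simp: prob_space.indep_vars_def[OF M])
  have rel: "rel_entropy (distr M borel Y) \<mu> = - haar_entropy \<mu> M Y" if "Y \<in> borel_measurable M" for Y
    using rel_entropy_haar[OF prob_space_axioms M, of Y] that
    by (simp add: distr_haar measurable_haar_iff)
  define Q where "Q i f \<longleftrightarrow> integrable \<mu> f \<and> (\<forall>x. 0 \<le> f x) \<and> (\<integral>x. f x \<partial>\<mu>) = 1 \<and>
    integrable \<mu> (\<lambda>x. f x * ln (f x)) \<and> distr M borel (X i) = density \<mu> (\<lambda>x. ennreal (f x)) \<and>
    haar_entropy \<mu> M (X i) = ereal (- (\<integral>x. f x * ln (f x) \<partial>\<mu>))" for i f
  have "\<forall>i\<in>{1..n}. \<exists>f. Q i f"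
  proof
    fix i assume i: "i \<in> {1..n}"
    show "\<exists>f. Q i f"
      unfolding Q_def by (rule haar_entropy_finite_density[OF M X[OF i] fin[OF i]]) blast
  qed
  then obtain f where Q: "\<forall>i\<in>{1..n}. Q i (f i)"
    using bchoice[of "{1..n}" Q] by blast
  have f: "integrable \<mu> (f i)" "\<And>x. 0 \<le> f i x" "(\<integral>x. f i x \<partial>\<mu>) = 1"
    "integrable \<mu> (\<lambda>x. f i x * ln (f i x))" "distr M borel (X i) = density \<mu> (\<lambda>x. ennreal (f i x))"
    "haar_entropy \<mu> M (X i) = ereal (- (\<integral>x. f i x * ln (f i x) \<partial>\<mu>))" if "i \<in> {1..n}" for i
    using bspec[OF Q that] unfolding Q_def by simp_all
  define D where "D i = (\<integral>x. f i x * ln (f i x) \<partial>\<mu>)" for i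
  have h: "haar_entropy \<mu> M (X i) = ereal (- D i)" if "i \<in> {1..n}" for i
    using f(6)[OF that] by (simp add: D_def)
  have D0: "0 \<le> D i" if "i \<in> {1..n}" for i
  proof -
    have "(\<integral>x. f i x - 1 \<partial>\<mu>) \<le> D i"
      unfolding D_def by (rule integral_mono) (use f[OF that] xlnx_ge in auto)
    then show ?thesis using f(1,3)[OF that] by simp
  qed
  \<comment> \<open>The index \<open>j\<close> stays outside \<open>I\<close> but inside the sum, so
    the base case is \<open>X j\<close> alone with an empty product.\<close>
  have main: "\<exists>p. integrable \<mu> p \<and> (\<forall>x. 0 \<le> p x) \<and> (\<integral>x. p x \<partial>\<mu>) = 1 \<and> integrable \<mu> (\<lambda>x. p x * ln (p x)) \<and>
      distr M borel (\<lambda>\<omega>. \<Sum>k\<in>insert j I. X k \<omega>) = density \<mu> (\<lambda>x. ennreal (p x)) \<and>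
      (\<integral>x. p x * ln (p x) \<partial>\<mu>) \<le> (\<Prod>i\<in>I. rfun (- D i)) * D j"
    if "finite I" "I \<subseteq> {1..n} - {j}" for I
    using that
  proof (induction I)
    case empty
    show ?case
      by (rule exI[of _ "f j"]) (use f[OF j] in \<open>simp add: D_def\<close>)
  next
    case (insert i I)
    then have i: "i \<in> {1..n}" "i \<noteq> j" "i \<notin> insert j I" "insert j I \<subseteq> {1..n}"
      using j by auto
    from insert obtain p where p: "integrable \<mu> p" "\<And>x. 0 \<le> p x" "(\<integral>x. p x \<partial>\<mu>) = 1"
      "integrable \<mu> (\<lambda>x. p x * ln (p x))"
      "distr M borel (\<lambda>\<omega>. \<Sum>k\<in>insert j I. X k \<omega>) = density \<mu> (\<lambda>x. ennreal (p x))"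
      "(\<integral>x. p x * ln (p x) \<partial>\<mu>) \<le> (\<Prod>i\<in>I. rfun (- D i)) * D j"
      by auto
    obtain q where q: "integrable \<mu> q" "\<And>x. 0 \<le> q x" "(\<integral>x. q x \<partial>\<mu>) = 1" "integrable \<mu> (\<lambda>x. q x * ln (q x))"
      "distr M borel (\<lambda>\<omega>. (\<Sum>k\<in>insert j I. X k \<omega>) + X i \<omega>) = density \<mu> (\<lambda>x. ennreal (q x))"
      "(\<integral>x. q x * ln (q x) \<partial>\<mu>) \<le> rfun (- (\<integral>x. f i x * ln (f i x) \<partial>\<mu>)) * (\<integral>x. p x * ln (p x) \<partial>\<mu>)"
      by (rule entropy_sum_indep_le[OF conn M indep_var_sum[OF M ind i(4,1,3)] p(5) f(5)[OF i(1)] p(1-4) f(1-4)[OF i(1)]]) (rule that)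
    have "(\<lambda>\<omega>. \<Sum>k\<in>insert j (insert i I). X k \<omega>) = (\<lambda>\<omega>. (\<Sum>k\<in>insert j I. X k \<omega>) + X i \<omega>)"
      using insert(1,2) i by (simp add: insert_commute[of j i] add.commute)
    moreover have "(\<integral>x. q x * ln (q x) \<partial>\<mu>) \<le> (\<Prod>i\<in>insert i I. rfun (- D i)) * D j"
    proof -
      \<comment> \<open>The cap 1/4 in \<open>rfun\<close> keeps the rate positive, so the induction
        hypothesis can be multiplied by it.\<close>
      have "rfun (- D i) * (\<integral>x. p x * ln (p x) \<partial>\<mu>) \<le> rfun (- D i) * ((\<Prod>i\<in>I. rfun (- D i)) * D j)"
        using p(6) rfun_ge[of "- D i"] by (intro mult_left_mono) auto
      with q(6)[folded D_def] show ?thesis using insert(1,2) by (simp add: mult.assoc)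
    qed
    ultimately show ?case
      using q(1-5) by (intro exI[of _ q]) auto
  qed
  define P where "P = (\<Prod>i\<in>{1..n} - {j}. rfun (- D i))"
  have "insert j ({1..n} - {j}) = {1..n}" using j by auto
  with main[of "{1..n} - {j}"] obtain p where p: "integrable \<mu> p" "\<And>x. 0 \<le> p x" "integrable \<mu> (\<lambda>x. p x * ln (p x))"
      "distr M borel (\<lambda>\<omega>. \<Sum>k=1..n. X k \<omega>) = density \<mu> (\<lambda>x. ennreal (p x))"
      "(\<integral>x. p x * ln (p x) \<partial>\<mu>) \<le> P * D j"
    by (auto simp: P_def)
  have Sm: "(\<lambda>\<omega>. \<Sum>k=1..n. X k \<omega>) \<in> borel_measurable M"
    by (rule measurable_group_sum) (rule X)
  have S: "rel_entropy (distr M borel (\<lambda>\<omega>. \<Sum>i=1..n. X i \<omega>)) \<mu> = ereal (\<integral>x. p x * ln (p x) \<partial>\<mu>)"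
    unfolding rel[OF Sm] haar_entropy_density[OF Sm p(4,1,2,3)] by simp
  have relX: "rel_entropy (distr M borel (X i)) \<mu> = ereal (D i)" if "i \<in> {1..n}" for i
    using rel[OF X[OF that]] h[OF that] by simp
  have PP: "(\<Prod>i\<in>{1..n} - {j}. rfun (real_of_ereal (haar_entropy \<mu> M (X i)))) = P"
    unfolding P_def using h by (intro prod.cong) auto
  have hj: "D j \<le> D i" if "i \<in> {1..n}" for i
  proof -
    have "haar_entropy \<mu> M (X i) \<le> haar_entropy \<mu> M (X j)"
      unfolding max using that by (intro Max_ge) auto
    then show ?thesis using h[OF that] h[OF j] by simp
  qed
  have minD: "(MIN i\<in>{1..n}. rel_entropy (distr M borel (X i)) \<mu>) = ereal (D j)"
  proof (rule Min_eqI)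
    show "ereal (D j) \<in> (\<lambda>i. rel_entropy (distr M borel (X i)) \<mu>) ` {1..n}"
      using relX[OF j] j by (intro image_eqI[of _ _ j]) simp_all
  qed (use relX hj in auto)
  have "(MIN i\<in>{1..n}. haar_entropy \<mu> M (X i)) \<in> (\<lambda>i. haar_entropy \<mu> M (X i)) ` {1..n}"
    using j by (intro Min_in) auto
  then obtain k where k: "k \<in> {1..n}" "(MIN i\<in>{1..n}. haar_entropy \<mu> M (X i)) = haar_entropy \<mu> M (X k)"
    by auto
  have Dk: "D i \<le> D k" if "i \<in> {1..n}" for i
  proof -
    have "haar_entropy \<mu> M (X k) \<le> haar_entropy \<mu> M (X i)"
      unfolding k(2)[symmetric] using that by (intro Min_le) auto
    then show ?thesis using h[OF that] h[OF k(1)] by simp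
  qed
  have "P \<le> (\<Prod>i\<in>{1..n} - {j}. rfun (- D k))"
    unfolding P_def
  proof (rule prod_mono)
    fix i assume "i \<in> {1..n} - {j}"
    then show "0 \<le> rfun (- D i) \<and> rfun (- D i) \<le> rfun (- D k)"
      using Dk[of i] D0[of i] rfun_ge[of "- D i"] by (auto intro: rfun_antimono)
  qed
  \<comment> \<open>Removing \<open>j\<close> from \<open>{1..n}\<close> leaves \<open>n - 1\<close>
    equal factors.\<close>
  also have "\<dots> = rfun (- D k) ^ (n - 1)"
    using j by simp
  finally have "P * D j \<le> rfun (- D k) ^ (n - 1) * D j"
    using D0[OF j] by (rule mult_right_mono)
  then show ?thesis
    unfolding S PP relX[OF j] minD k(2) h[OF k(1)] using p(5) by simp
qed

end

theorem corollary3p1: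
  fixes \<mu> :: "'g::topological_ab_group_add measure"
    and M :: "'b measure"
    and X :: "nat \<Rightarrow> 'b \<Rightarrow> 'g"
    and n j :: nat
  assumes "compact (UNIV :: 'g set)"
    and "connected (UNIV :: 'g set)"
    and "metrizable_space (euclidean :: 'g topology)"
    and "haar_prob \<mu>"
    and "prob_space M"
    and "n \<ge> 1"
    and "prob_space.indep_vars M (\<lambda>_. borel) X {1..n}"
    and "\<And>i. i \<in> {1..n} \<Longrightarrow> haar_entropy \<mu> M (X i) > - \<infinity>"
    and "j \<in> {1..n}"
    and "haar_entropy \<mu> M (X j) = (MAX i\<in>{1..n}. haar_entropy \<mu> M (X i))"
  shows "rel_entropy (distr M borel (\<lambda>\<omega>. \<Sum>i=1..n. X i \<omega>)) \<mu>
           \<le> ereal (\<Prod>i\<in>{1..n} - {j}. rfun (real_of_ereal (haar_entropy \<mu> M (X i))))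
               * rel_entropy (distr M borel (X j)) \<mu>
       \<and> ereal (\<Prod>i\<in>{1..n} - {j}. rfun (real_of_ereal (haar_entropy \<mu> M (X i))))
               * rel_entropy (distr M borel (X j)) \<mu>
           \<le> ereal (rfun (real_of_ereal (MIN i\<in>{1..n}. haar_entropy \<mu> M (X i))) ^ (n - 1))
               * (MIN i\<in>{1..n}. rel_entropy (distr M borel (X i)) \<mu>)"
  by (rule haar_group.rel_entropy_sum_le[OF haar_group.intro[OF
        compact_metrizable_countable_base[OF assms(1,3)] assms(4)] assms(2,5,7-10)])

end
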